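(* Let $p$ be an odd prime and let $G$ be a non-periodic GGS-group over the $p$-adic tree. Then the quotient $G/\mathrm{st}_G(n)$ is not a Beauville group for any $n\ge 1$.
   Context: The $p$-adic tree $\mathcal{T}$ is the rooted tree whose vertices are the words over $X=\{1,\dots,p\}$ (the free monoid $X^*$), with root the empty word, where the children of a vertex $v$ are the words $vx$, $x\in X$; level $n$ consists of the words of length $n$. $\mathrm{Aut}\,\mathcal{T}$ is the group of bijections of the vertices preserving incidence (so fixing the root and preserving levels), acting on the right. $\mathrm{st}(n)$ is the subgroup of $\mathrm{Aut}\,\mathcal{T}$ fixing all vertices of level $n$, and for $G\le \mathrm{Aut}\,\mathcal{T}$, $\mathrm{st}_G(n)=\mathrm{st}(n)\cap G$. The map $\psi:\mathrm{st}(1)\to \mathrm{Aut}\,\mathcal{T}\times\overset{p}{\cdots}\times \mathrm{Aut}\,\mathcal{T}$, $g\mapsto(g_1,\dots,g_p)$, is the isomorphism where $g_i$ is the automorphism of $\mathcal{T}$ induced by $g$ on the subtree hanging from the vertex $i$. GGS-group: let $a\in\mathrm{Aut}\,\mathcal{T}$ be the rooted automorphism permuting rigidly the $p$ subtrees hanging from the root according to the permutation $(1\,2\,\dots\,p)$ (it has order $p$). Given a non-zero vector $\mathbf{e}=(e_1,\dots,e_{p-1})\in\mathbb{F}_p^{p-1}$, define $b\in\mathrm{st}(1)$ recursively by $\psi(b)=(a^{e_1},\dots,a^{e_{p-1}},b)$. The GGS-group with defining vector $\mathbf{e}$ is $G=\langle a,b\rangle$. A group is periodic if all its elements have finite order.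 It is known (Vovkivsky) that $G$ is periodic if and only if $\sum_{i=1}^{p-1}e_i=0$ in $\mathbb{F}_p$. Beauville group: a finite $2$-generator group $H$ is a Beauville group if there are two pairs $\{x_1,y_1\}$, $\{x_2,y_2\}$, each generating $H$, with $\Sigma(x_1,y_1)\cap\Sigma(x_2,y_2)=1$, where $\Sigma(x_i,y_i)=\bigcup_{g\in H}\big(\langle x_i\rangle^g\cup\langle y_i\rangle^g\cup\langle x_iy_i\rangle^g\big)$. *)

theory Defs
  imports "HOL-Algebra.Bij" "HOL-Algebra.Generated_Groups" "HOL-Number_Theory.Residues"
begin

section \<open>The p-adic tree and its automorphism group\<close>

definition tree_words :: "nat \<Rightarrow> nat list set" where
  "tree_words p = {w. set w \<subseteq> {1..p}}"

definition tree_level :: "nat \<Rightarrow> nat \<Rightarrow> nat list set" where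
  "tree_level p n = {w \<in> tree_words p. length w = n}"

definition tree_incident :: "nat \<Rightarrow> nat list \<Rightarrow> nat list \<Rightarrow> bool" where
  "tree_incident p u v \<longleftrightarrow> (\<exists>x\<in>{1..p}. v = u @ [x] \<or> u = v @ [x])"

text \<open>
  Automorphisms are extensional on the vertex set, so that equality of functions is
  equality of automorphisms. The action is on the right: the product of \<open>f\<close> and \<open>g\<close>
  applies \<open>f\<close> first.
\<close>

definition tree_aut :: "nat \<Rightarrow> (nat list \<Rightarrow> nat list) monoid" where
  "tree_aut p =
     \<lparr>carrier = {f \<in> Bij (tree_words p). \<forall>u\<in>tree_words p. \<forall>v\<in>tree_words p.
                   tree_incident p (f u) (f v) \<longleftrightarrow> tree_incident p u v},
      monoid.mult = \<lambda>f g. compose (tree_words p) g f,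
      one = \<lambda>v\<in>tree_words p. v\<rparr>"

definition level_stabilizer :: "nat \<Rightarrow> nat \<Rightarrow> (nat list \<Rightarrow> nat list) set" where
  "level_stabilizer p n = {g \<in> carrier (tree_aut p). \<forall>v\<in>tree_level p n. g v = v}"

definition tree_psi :: "nat \<Rightarrow> (nat list \<Rightarrow> nat list) \<Rightarrow> nat \<Rightarrow> nat list \<Rightarrow> nat list" where
  "tree_psi p g = (\<lambda>i\<in>{1..p}. \<lambda>w\<in>tree_words p. tl (g (i # w)))"


section \<open>GGS-groups\<close>

text \<open>The permutation \<open>(1 2 \<dots> p)\<close> sends \<open>x\<close> to \<open>x mod p + 1\<close>.\<close>

primrec rooted_map :: "nat \<Rightarrow> nat list \<Rightarrow> nat list" where
  "rooted_map p [] = []"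
| "rooted_map p (x # w) = (x mod p + 1) # w"

definition ggs_a :: "nat \<Rightarrow> nat list \<Rightarrow> nat list" where
  "ggs_a p = restrict (rooted_map p) (tree_words p)"

text \<open>
  The recursion \<open>\<psi>(b) = (a^e\<^sub>1, \<dots>, a^e\<^sub>p\<^sub>-\<^sub>1, b)\<close>, written out as an action on words; the
  lemmas \<open>tree_psi_ggs_b\<close> and \<open>ggs_b_unique\<close> below recover it.
\<close>

primrec directed_map :: "nat \<Rightarrow> (nat \<Rightarrow> int) \<Rightarrow> nat list \<Rightarrow> nat list" where
  "directed_map p e [] = []"
| "directed_map p e (x # w) =
     x # (if x = p then directed_map p e w else (ggs_a p [^]\<^bsub>tree_aut p\<^esub> e x) w)"

definition ggs_b :: "nat \<Rightarrow> (nat \<Rightarrow> int) \<Rightarrow> nat list \<Rightarrow> nat list" where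
  "ggs_b p e = restrict (directed_map p e) (tree_words p)"

text \<open>
  Non-zero vectors of length \<open>p - 1\<close> over the field of \<open>p\<close> elements; entries outside
  \<open>{1..p-1}\<close> are irrelevant.
\<close>

definition defining_vector :: "nat \<Rightarrow> (nat \<Rightarrow> int) \<Rightarrow> bool" where
  "defining_vector p e \<longleftrightarrow>
     e \<in> {1..p-1} \<rightarrow> carrier (residue_ring (int p)) \<and>
     (\<exists>i\<in>{1..p-1}. e i \<noteq> \<zero>\<^bsub>residue_ring (int p)\<^esub>)"

definition GGS_group :: "nat \<Rightarrow> (nat \<Rightarrow> int) \<Rightarrow> (nat list \<Rightarrow> nat list) monoid" where
  "GGS_group p e = subgroup_generated (tree_aut p) {ggs_a p, ggs_b p e}"

definition GGS_stabilizer :: "nat \<Rightarrow> (nat \<Rightarrow> int) \<Rightarrow> nat \<Rightarrow> (nat list \<Rightarrow> nat list) set" where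
  "GGS_stabilizer p e n = level_stabilizer p n \<inter> carrier (GGS_group p e)"


section \<open>Periodic groups and Beauville groups\<close>

definition periodic_group :: "('a, 'b) monoid_scheme \<Rightarrow> bool" where
  "periodic_group G \<longleftrightarrow> (\<forall>g\<in>carrier G. \<exists>m::nat. m > 0 \<and> g [^]\<^bsub>G\<^esub> m = \<one>\<^bsub>G\<^esub>)"

definition conj_set :: "('a, 'b) monoid_scheme \<Rightarrow> 'a \<Rightarrow> 'a set \<Rightarrow> 'a set" where
  "conj_set G g K = (\<lambda>k. inv\<^bsub>G\<^esub> g \<otimes>\<^bsub>G\<^esub> k \<otimes>\<^bsub>G\<^esub> g) ` K"

definition beauville_Sigma :: "('a, 'b) monoid_scheme \<Rightarrow> 'a \<Rightarrow> 'a \<Rightarrow> 'a set" where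
  "beauville_Sigma H x y =
     (\<Union>g\<in>carrier H. conj_set H g (generate H {x}) \<union> conj_set H g (generate H {y})
        \<union> conj_set H g (generate H {x \<otimes>\<^bsub>H\<^esub> y}))"

definition beauville_group :: "('a, 'b) monoid_scheme \<Rightarrow> bool" where
  "beauville_group H \<longleftrightarrow> group H \<and> finite (carrier H) \<and>
     (\<exists>x1\<in>carrier H. \<exists>y1\<in>carrier H. \<exists>x2\<in>carrier H. \<exists>y2\<in>carrier H.
        generate H {x1, y1} = carrier H \<and> generate H {x2, y2} = carrier H \<and>
        beauville_Sigma H x1 y1 \<inter> beauville_Sigma H x2 y2 = {\<one>\<^bsub>H\<^esub>})"


section \<open>Well-definedness\<close>

lemma tree_words_Nil [simp]: "[] \<in> tree_words p"
  by (simp add: tree_words_def)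

lemma tree_words_Cons [simp]: "x # w \<in> tree_words p \<longleftrightarrow> x \<in> {1..p} \<and> w \<in> tree_words p"
  by (auto simp: tree_words_def)

lemma tree_words_append [simp]:
  "u @ v \<in> tree_words p \<longleftrightarrow> u \<in> tree_words p \<and> v \<in> tree_words p"
  by (auto simp: tree_words_def)

lemma tree_aut_one: "\<one>\<^bsub>tree_aut p\<^esub> = (\<lambda>v\<in>tree_words p. v)"
  by (simp add: tree_aut_def)

lemma tree_aut_mult: "f \<otimes>\<^bsub>tree_aut p\<^esub> g = compose (tree_words p) g f"
  by (simp add: tree_aut_def)

lemma tree_aut_carrier:
  "f \<in> carrier (tree_aut p) \<longleftrightarrow> f \<in> Bij (tree_words p) \<and>
     (\<forall>u\<in>tree_words p. \<forall>v\<in>tree_words p. tree_incident p (f u) (f v) \<longleftrightarrow> tree_incident p u v)"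
  by (simp add: tree_aut_def)

lemma tree_aut_closed:
  assumes "f \<in> carrier (tree_aut p)" "w \<in> tree_words p"
  shows "f w \<in> tree_words p"
  using assms Bij_imp_funcset by (fastforce simp: tree_aut_carrier)

lemma tree_aut_inj:
  assumes "f \<in> carrier (tree_aut p)" "u \<in> tree_words p" "v \<in> tree_words p" "f u = f v"
  shows "u = v"
  using assms by (auto simp: tree_aut_carrier Bij_def bij_betw_def dest: inj_onD)

lemma group_tree_aut: "group (tree_aut p)"
proof (rule groupI)
  fix f g assume fg: "f \<in> carrier (tree_aut p)" "g \<in> carrier (tree_aut p)"
  then show "f \<otimes>\<^bsub>tree_aut p\<^esub> g \<in> carrier (tree_aut p)"
    using tree_aut_closed[OF fg(1)]
    by (auto simp: tree_aut_carrier tree_aut_mult compose_Bij compose_eq)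
next
  show "\<one>\<^bsub>tree_aut p\<^esub> \<in> carrier (tree_aut p)"
    by (auto simp: tree_aut_carrier tree_aut_one id_Bij)
next
  fix f g h
  assume *: "f \<in> carrier (tree_aut p)" "g \<in> carrier (tree_aut p)" "h \<in> carrier (tree_aut p)"
  show "f \<otimes>\<^bsub>tree_aut p\<^esub> g \<otimes>\<^bsub>tree_aut p\<^esub> h = f \<otimes>\<^bsub>tree_aut p\<^esub> (g \<otimes>\<^bsub>tree_aut p\<^esub> h)"
    using tree_aut_closed[OF *(1)] by (auto simp: tree_aut_mult compose_def fun_eq_iff)
next
  fix f assume f: "f \<in> carrier (tree_aut p)"
  then have ext: "f \<in> extensional (tree_words p)"
    by (simp add: tree_aut_carrier Bij_imp_extensional)
  show "\<one>\<^bsub>tree_aut p\<^esub> \<otimes>\<^bsub>tree_aut p\<^esub> f = f"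
    unfolding tree_aut_mult tree_aut_one
    by (rule extensionalityI[OF compose_extensional ext]) (simp add: compose_eq)
  define W where "W = tree_words p"
  define g where "g = (\<lambda>x\<in>W. inv_into W f x)"
  have fB: "f \<in> Bij W" using f by (simp add: tree_aut_carrier W_def)
  have gB: "g \<in> Bij W" unfolding g_def using fB by (rule restrict_inv_into_Bij)
  have gW: "g u \<in> W" if "u \<in> W" for u using gB that Bij_imp_funcset by blast
  have fg: "f (g u) = u" if "u \<in> W" for u
    using fB that by (simp add: g_def Bij_def bij_betw_def f_inv_into_f)
  have "tree_incident p (g u) (g v) \<longleftrightarrow> tree_incident p u v" if "u \<in> W" "v \<in> W" for u v
  proof -
    have "tree_incident p (f (g u)) (f (g v)) \<longleftrightarrow> tree_incident p (g u) (g v)"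
      using f gW[OF that(1)] gW[OF that(2)] unfolding tree_aut_carrier W_def by blast
    then show ?thesis using fg that by simp
  qed
  then have "g \<in> carrier (tree_aut p)"
    using gB unfolding tree_aut_carrier W_def by blast
  moreover have "g \<otimes>\<^bsub>tree_aut p\<^esub> f = \<one>\<^bsub>tree_aut p\<^esub>"
    unfolding tree_aut_mult tree_aut_one W_def[symmetric] compose_def
    by (rule restrict_ext) (rule fg)
  ultimately show "\<exists>g\<in>carrier (tree_aut p). g \<otimes>\<^bsub>tree_aut p\<^esub> f = \<one>\<^bsub>tree_aut p\<^esub>" by blast
qed

lemma tree_incident_sym: "tree_incident p u v \<longleftrightarrow> tree_incident p v u"
  by (auto simp: tree_incident_def)

lemma tree_aut_Nil:
  assumes f: "f \<in> carrier (tree_aut p)" and p: "p \<ge> 1"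
  shows "f [] = []"
proof (rule ccontr)
  assume "f [] \<noteq> []"
  then obtain u y where uy: "f [] = u @ [y]" by (metis rev_exhaust)
  define N where "N v = {w \<in> tree_words p. tree_incident p v w}" for v
  have W: "u @ [y] \<in> tree_words p" using tree_aut_closed[OF f, of "[]"] uy by simp
  have "N [] = (\<lambda>x. [x]) ` {1..p}"
    by (auto simp: N_def tree_incident_def)
  then have c0: "card (N []) = p" "finite (N [])" by (simp_all add: card_image inj_on_def)
  have im: "f ` N [] = N (f [])"
  proof
    show "f ` N [] \<subseteq> N (f [])"
      using f tree_aut_closed[OF f] by (auto simp: N_def tree_aut_carrier)
    show "N (f []) \<subseteq> f ` N []"
    proof
      fix w assume w: "w \<in> N (f [])"
      then have "w \<in> f ` tree_words p"
        using f by (simp add: N_def tree_aut_carrier Bij_def bij_betw_def)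
      then obtain v where "v \<in> tree_words p" "w = f v" by blast
      with w f show "w \<in> f ` N []" by (auto simp: N_def tree_aut_carrier)
    qed
  qed
  have "N (u @ [y]) = insert u ((\<lambda>x. u @ [y, x]) ` {1..p})"
    using W by (auto simp: N_def tree_incident_def)
  moreover have "card \<dots> = Suc p"
    by (subst card_insert_disjoint) (auto simp: card_image inj_on_def)
  ultimately have "card (f ` N []) = Suc p" using im uy by simp
  with card_image_le[OF c0(2), of f] c0(1) show False by simp
qed

lemma tree_aut_length:
  assumes f: "f \<in> carrier (tree_aut p)" and p: "p \<ge> 1" and "w \<in> tree_words p"
  shows "length (f w) = length w"
  using assms(3)
proof (induction "length w" arbitrary: w rule: less_induct)
  case less
  show ?case
  proof (cases w rule: rev_cases)
    case Nil
    then show ?thesis using tree_aut_Nil[OF f p] by simp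
  next
    case (snoc u x)
    have inc: "tree_incident p (f v) (f v')"
      if "v \<in> tree_words p" "v' \<in> tree_words p" "tree_incident p v v'" for v v'
      using f that by (simp add: tree_aut_carrier)
    have uw: "u \<in> tree_words p" "x \<in> {1..p}" using less.prems snoc by auto
    have lu: "length (f u) = length u" using less.hyps[of u] snoc uw by simp
    have i1: "tree_incident p (f u) (f w)"
      using inc[of u w] uw less.prems snoc by (auto simp: tree_incident_def)
    have "\<not> (\<exists>y. f u = f w @ [y])"
    proof
      assume "\<exists>y. f u = f w @ [y]"
      then obtain y where y: "f u = f w @ [y]" by blast
      then obtain v z where vz: "u = v @ [z]" using lu by (cases u rule: rev_cases) auto
      have v: "v \<in> tree_words p" using uw vz by simp
      have lv: "length (f v) = length v" using less.hyps[of v] snoc vz v by simp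
      have "tree_incident p (f v) (f u)"
        using inc[of v u] v uw vz by (auto simp: tree_incident_def)
      then have "f v = f w" using y lv lu vz by (auto simp: tree_incident_def)
      then have "v = w" using tree_aut_inj[OF f] v less.prems by blast
      then show False using snoc vz by simp
    qed
    then show ?thesis using i1 lu snoc by (auto simp: tree_incident_def)
  qed
qed

lemma level_stabilizer_normal:
  assumes p: "p \<ge> 1"
  shows "level_stabilizer p n \<lhd> tree_aut p"
proof -
  interpret A: group "tree_aut p" by (rule group_tree_aut)
  have sub: "v \<in> tree_words p" if "v \<in> tree_level p n" for v
    using that by (simp add: tree_level_def)
  have lev: "f v \<in> tree_level p n" if "f \<in> carrier (tree_aut p)" "v \<in> tree_level p n" for f v
    using that tree_aut_length[OF that(1) p] tree_aut_closed[OF that(1)]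
    by (simp add: tree_level_def)
  have mult: "(f \<otimes>\<^bsub>tree_aut p\<^esub> g) v = g (f v)" if "v \<in> tree_words p" for f g v
    using that by (simp add: tree_aut_mult compose_eq)
  have invr: "(inv\<^bsub>tree_aut p\<^esub> f) (f v) = v"
    if "f \<in> carrier (tree_aut p)" "v \<in> tree_words p" for f v
    using that A.r_inv[OF that(1)] mult[of v f "inv\<^bsub>tree_aut p\<^esub> f"] by (simp add: tree_aut_one)
  show ?thesis
    unfolding A.normal_inv_iff
  proof (intro conjI ballI)
    show "subgroup (level_stabilizer p n) (tree_aut p)"
    proof (rule A.subgroupI)
      have "\<one>\<^bsub>tree_aut p\<^esub> \<in> level_stabilizer p n"
        using sub A.one_closed by (simp add: level_stabilizer_def tree_aut_one)
      then show "level_stabilizer p n \<noteq> {}" by blast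
    next
      fix f assume "f \<in> level_stabilizer p n"
      then show "inv\<^bsub>tree_aut p\<^esub> f \<in> level_stabilizer p n"
        using sub invr[of f] by (force simp: level_stabilizer_def)
    qed (auto simp: level_stabilizer_def mult sub)
    fix x h assume x: "x \<in> carrier (tree_aut p)" and h: "h \<in> level_stabilizer p n"
    show "x \<otimes>\<^bsub>tree_aut p\<^esub> h \<otimes>\<^bsub>tree_aut p\<^esub> inv\<^bsub>tree_aut p\<^esub> x \<in> level_stabilizer p n"
      using x h sub lev[OF x] invr[OF x] by (auto simp: level_stabilizer_def mult)
  qed
qed

lemma GGS_quotient_group:
  assumes "p \<ge> 1"
  shows "group (GGS_group p e Mod GGS_stabilizer p e n)"
proof -
  interpret A: group "tree_aut p" by (rule group_tree_aut)
  have "subgroup (carrier (GGS_group p e)) (tree_aut p)"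
    unfolding GGS_group_def carrier_subgroup_generated
    by (rule A.generate_is_subgroup) simp
  from A.normal_Int_subgroup[OF this level_stabilizer_normal[OF assms]]
  have "GGS_stabilizer p e n \<lhd> GGS_group p e"
    by (simp add: GGS_stabilizer_def GGS_group_def subgroup_generated_def)
  then show ?thesis by (rule normal.factorgroup_is_group)
qed

lemma finite_GGS_quotient:
  assumes p: "p \<ge> 1"
  shows "finite (carrier (GGS_group p e Mod GGS_stabilizer p e n))"
proof -
  interpret A: group "tree_aut p" by (rule group_tree_aut)
  define G where "G = GGS_group p e"
  define S where "S = GGS_stabilizer p e n"
  define L where "L = tree_level p n"
  have sg: "subgroup (carrier G) (tree_aut p)"
    unfolding G_def GGS_group_def carrier_subgroup_generated
    by (rule A.generate_is_subgroup) simp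
  have Gdef: "G = tree_aut p\<lparr>carrier := carrier G\<rparr>"
    by (simp add: G_def GGS_group_def subgroup_generated_def)
  interpret G: group G
    using A.subgroup_imp_group[OF sg] Gdef by simp
  have GA: "g \<in> carrier (tree_aut p)" if "g \<in> carrier G" for g
    using sg that by (meson subgroup.mem_carrier)
  have mult: "(f \<otimes>\<^bsub>G\<^esub> g) v = g (f v)" if "v \<in> tree_words p" for f g v
    using that by (subst Gdef) (simp add: tree_aut_mult compose_eq)
  have one: "\<one>\<^bsub>G\<^esub> = (\<lambda>v\<in>tree_words p. v)"
    by (subst Gdef) (simp add: tree_aut_one)
  have "S \<lhd> G"
    using A.normal_Int_subgroup[OF sg level_stabilizer_normal[OF p, of n]] Gdef
    by (simp add: S_def G_def GGS_stabilizer_def)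
  then have Ssub: "subgroup S G" by (simp add: normal_def)
  have lev: "g v \<in> L" if "g \<in> carrier G" "v \<in> L" for g v
    using that tree_aut_length[OF GA[OF that(1)] p] tree_aut_closed[OF GA[OF that(1)]]
    by (simp add: tree_level_def L_def)
  have Lsub: "L \<subseteq> tree_words p" by (auto simp: L_def tree_level_def)
  have finL: "finite L"
  proof (rule finite_subset)
    show "L \<subseteq> {w. set w \<subseteq> {1..p} \<and> length w = n}"
      by (auto simp: L_def tree_level_def tree_words_def)
  qed (simp add: finite_lists_length_eq)
  define r where "r g = restrict g L" for g :: "nat list \<Rightarrow> nat list"
  have "r ` carrier G \<subseteq> L \<rightarrow>\<^sub>E L" using lev by (auto simp: r_def)
  then have fin: "finite (r ` carrier G)"
    by (rule finite_subset) (simp add: finL finite_PiE)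
  have coset: "S #>\<^bsub>G\<^esub> g = S #>\<^bsub>G\<^esub> h"
    if g: "g \<in> carrier G" and h: "h \<in> carrier G" and "r g = r h" for g h
  proof -
    have gh: "g v = h v" if "v \<in> L" for v
      using \<open>r g = r h\<close> that unfolding r_def by (metis restrict_apply')
    define k where "k = g \<otimes>\<^bsub>G\<^esub> inv\<^bsub>G\<^esub> h"
    have kG: "k \<in> carrier G" using g h by (simp add: k_def)
    have "k v = v" if v: "v \<in> L" for v
    proof -
      have "k v = (h \<otimes>\<^bsub>G\<^esub> inv\<^bsub>G\<^esub> h) v" using v Lsub gh by (auto simp: k_def mult)
      then show ?thesis using h v Lsub by (auto simp: one)
    qed
    then have "k \<in> S"
      using kG GA by (auto simp: S_def GGS_stabilizer_def level_stabilizer_def L_def simp flip: G_def)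
    moreover have "g = k \<otimes>\<^bsub>G\<^esub> h" using g h by (simp add: k_def G.m_assoc)
    ultimately have "g \<in> S #>\<^bsub>G\<^esub> h" by (auto simp: r_coset_def)
    then show ?thesis using G.repr_independence[OF _ h Ssub] by simp
  qed
  define c where "c q = S #>\<^bsub>G\<^esub> (SOME g. g \<in> carrier G \<and> r g = q)" for q
  have "S #>\<^bsub>G\<^esub> g \<in> c ` r ` carrier G" if g: "g \<in> carrier G" for g
  proof -
    have "(SOME g'. g' \<in> carrier G \<and> r g' = r g) \<in> carrier G \<and>
          r (SOME g'. g' \<in> carrier G \<and> r g' = r g) = r g"
      by (rule someI[of "\<lambda>g'. g' \<in> carrier G \<and> r g' = r g" g]) (use g in simp)
    then have "c (r g) = S #>\<^bsub>G\<^esub> g" unfolding c_def using coset g by blast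
    then show ?thesis using g by force
  qed
  then have "carrier (G Mod S) \<subseteq> c ` r ` carrier G"
    by (auto simp: FactGroup_def RCOSETS_def)
  then have "finite (carrier (G Mod S))" by (rule finite_subset) (simp add: fin)
  then show ?thesis by (simp add: G_def S_def)
qed

text \<open>The generators are automorphisms, and \<open>b\<close> is determined by its recursion.\<close>

lemma mod_Suc_cycle_inj:
  assumes "x \<in> {1..p}" "y \<in> {1..p}" "x mod p = y mod (p::nat)"
  shows "x = y"
  using assms by (cases "x = p"; cases "y = p") auto

lemma tree_autI:
  assumes W: "\<And>w. w \<in> tree_words p \<Longrightarrow> f w \<in> tree_words p"
    and len: "\<And>w. w \<in> tree_words p \<Longrightarrow> length (f w) = length w"
    and inj: "inj_on f (tree_words p)"
    and ext: "f \<in> extensional (tree_words p)"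
    and pre: "\<And>w x. w @ [x] \<in> tree_words p \<Longrightarrow> \<exists>y. f (w @ [x]) = f w @ [y]"
  shows "f \<in> carrier (tree_aut p)"
proof -
  have "f ` tree_words p = tree_words p"
  proof
    show "f ` tree_words p \<subseteq> tree_words p" using W by blast
    show "tree_words p \<subseteq> f ` tree_words p"
    proof
      fix w assume w: "w \<in> tree_words p"
      have fin: "finite (tree_level p (length w))"
      proof (rule finite_subset)
        show "tree_level p (length w) \<subseteq> {v. set v \<subseteq> {1..p} \<and> length v = length w}"
          by (auto simp: tree_level_def tree_words_def)
      qed (simp add: finite_lists_length_eq)
      have "f ` tree_level p (length w) = tree_level p (length w)"
      proof (rule endo_inj_surj[OF fin])
        show "f ` tree_level p (length w) \<subseteq> tree_level p (length w)"
          using W len by (auto simp: tree_level_def)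
        show "inj_on f (tree_level p (length w))"
          using inj by (rule inj_on_subset) (auto simp: tree_level_def)
      qed
      moreover have "w \<in> tree_level p (length w)" using w by (simp add: tree_level_def)
      ultimately have "w \<in> f ` tree_level p (length w)" by simp
      then show "w \<in> f ` tree_words p" by (auto simp: tree_level_def)
    qed
  qed
  then have B: "f \<in> Bij (tree_words p)" using inj ext by (simp add: Bij_def bij_betw_def)
  have child: "(\<exists>y\<in>{1..p}. f v = f u @ [y]) \<longleftrightarrow> (\<exists>x\<in>{1..p}. v = u @ [x])"
    if u: "u \<in> tree_words p" and v: "v \<in> tree_words p" for u v
  proof
    assume "\<exists>x\<in>{1..p}. v = u @ [x]"
    then show "\<exists>y\<in>{1..p}. f v = f u @ [y]"
      using pre[of u] v W[OF v] by fastforce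
  next
    assume "\<exists>y\<in>{1..p}. f v = f u @ [y]"
    then obtain y where y: "f v = f u @ [y]" by blast
    then have "v \<noteq> []" using len[OF v] by auto
    then obtain v' x where v': "v = v' @ [x]" by (metis rev_exhaust)
    then obtain z where "f v = f v' @ [z]" using pre v by blast
    then have "f v' = f u" using y by simp
    then have "v' = u" using inj u v v' by (auto dest: inj_onD)
    then show "\<exists>x\<in>{1..p}. v = u @ [x]" using v v' by auto
  qed
  have "tree_incident p (f u) (f v) \<longleftrightarrow> tree_incident p u v"
    if "u \<in> tree_words p" "v \<in> tree_words p" for u v
    using child[OF that] child[OF that(2,1)] unfolding tree_incident_def by blast
  then show ?thesis using B by (simp add: tree_aut_carrier)
qed

lemma ggs_a_in_tree_aut:
  assumes p: "p \<ge> 1"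
  shows "ggs_a p \<in> carrier (tree_aut p)"
proof (rule tree_autI)
  have lt: "x mod p < p" for x using p by simp
  show "ggs_a p w \<in> tree_words p" if "w \<in> tree_words p" for w
    using that lt by (cases w) (auto simp: ggs_a_def Suc_le_eq)
  show "length (ggs_a p w) = length w" if "w \<in> tree_words p" for w
    using that by (cases w) (auto simp: ggs_a_def)
  show "inj_on (ggs_a p) (tree_words p)"
  proof (rule inj_onI)
    fix u v assume "u \<in> tree_words p" "v \<in> tree_words p" "ggs_a p u = ggs_a p v"
    then show "u = v"
      by (cases u; cases v) (auto simp: ggs_a_def intro: mod_Suc_cycle_inj)
  qed
  show "\<exists>y. ggs_a p (w @ [x]) = ggs_a p w @ [y]" if "w @ [x] \<in> tree_words p" for w x
    using that by (cases w) (auto simp: ggs_a_def)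
qed (simp add: ggs_a_def)

lemma tree_aut_snoc:
  assumes f: "f \<in> carrier (tree_aut p)" and p: "p \<ge> 1" and w: "w @ [x] \<in> tree_words p"
  shows "\<exists>y. f (w @ [x]) = f w @ [y]"
proof -
  have "tree_incident p w (w @ [x])" using w by (auto simp: tree_incident_def)
  then have "tree_incident p (f w) (f (w @ [x]))"
    using f w by (simp add: tree_aut_carrier)
  then show ?thesis
    using tree_aut_length[OF f p, of w] tree_aut_length[OF f p w] w
    by (auto simp: tree_incident_def)
qed

lemma ggs_b_in_stabilizer:
  assumes p: "p \<ge> 1"
  shows "ggs_b p e \<in> level_stabilizer p 1"
proof -
  interpret A: group "tree_aut p" by (rule group_tree_aut)
  define s where "s x = ggs_a p [^]\<^bsub>tree_aut p\<^esub> e x" for x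
  have s: "s x \<in> carrier (tree_aut p)" for x
    using ggs_a_in_tree_aut[OF p] by (simp add: s_def)
  have eq: "directed_map p e (x # w) = x # (if x = p then directed_map p e w else s x w)" for x w
    by (simp add: s_def)
  note [simp del] = directed_map.simps(2) and [simp] = eq
  have W: "directed_map p e w \<in> tree_words p \<and> length (directed_map p e w) = length w"
    if "w \<in> tree_words p" for w
    using that
    by (induction w) (auto simp: tree_aut_closed[OF s] tree_aut_length[OF s p])
  have inj: "u = v"
    if "u \<in> tree_words p" "v \<in> tree_words p" "directed_map p e u = directed_map p e v" for u v
    using that
  proof (induction u arbitrary: v)
    case Nil
    then show ?case by (cases v) auto
  next
    case (Cons x u)
    then show ?case by (cases v) (auto split: if_splits dest: tree_aut_inj[OF s])
  qed
  have pre: "\<exists>y. directed_map p e (w @ [x]) = directed_map p e w @ [y]"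
    if "w @ [x] \<in> tree_words p" for w x
    using that
  proof (induction w)
    case Nil
    then show ?case using tree_aut_Nil[OF s p] by auto
  next
    case (Cons z w)
    then show ?case using tree_aut_snoc[OF s p, of w x] by auto
  qed
  have "ggs_b p e \<in> carrier (tree_aut p)"
  proof (rule tree_autI)
    show "inj_on (ggs_b p e) (tree_words p)"
      using inj by (auto simp: ggs_b_def inj_on_def)
  qed (use W pre in \<open>auto simp: ggs_b_def\<close>)
  moreover have "ggs_b p e v = v" if "v \<in> tree_level p 1" for v
    using that tree_aut_Nil[OF s p]
    by (auto simp: tree_level_def ggs_b_def length_Suc_conv)
  ultimately show ?thesis by (simp add: level_stabilizer_def)
qed

lemma tree_psi_ggs_b:
  assumes "p \<ge> 1"
  shows "tree_psi p (ggs_b p e) =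
    (\<lambda>i\<in>{1..p}. if i = p then ggs_b p e else ggs_a p [^]\<^bsub>tree_aut p\<^esub> e i)"
proof -
  interpret A: group "tree_aut p" by (rule group_tree_aut)
  have ext: "ggs_a p [^]\<^bsub>tree_aut p\<^esub> e i \<in> extensional (tree_words p)" for i
    using A.int_pow_closed[OF ggs_a_in_tree_aut[OF assms], of "e i"]
    by (simp add: tree_aut_carrier Bij_imp_extensional)
  have "(\<lambda>w\<in>tree_words p. tl (ggs_b p e (i # w))) =
      (if i = p then ggs_b p e else ggs_a p [^]\<^bsub>tree_aut p\<^esub> e i)" if "i \<in> {1..p}" for i
    using that by (intro extensionalityI[OF restrict_extensional])
      (auto simp: ggs_b_def ext)
  then show ?thesis unfolding tree_psi_def by (intro restrict_ext) blast
qed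

lemma ggs_b_unique:
  assumes p: "p \<ge> 1" and c: "c \<in> level_stabilizer p 1"
    and psi: "tree_psi p c = (\<lambda>i\<in>{1..p}. if i = p then c else ggs_a p [^]\<^bsub>tree_aut p\<^esub> e i)"
  shows "c = ggs_b p e"
proof -
  have cA: "c \<in> carrier (tree_aut p)" using c by (simp add: level_stabilizer_def)
  have hd: "\<exists>u. c (i # w) = i # u" if "i \<in> {1..p}" "w \<in> tree_words p" for i w
    using that(2)
  proof (induction w rule: rev_induct)
    case Nil
    have "c [i] = [i]" using c that(1) by (auto simp: level_stabilizer_def tree_level_def)
    then show ?case by simp
  next
    case (snoc x w)
    then show ?case using tree_aut_snoc[OF cA p, of "i # w" x] that(1) by auto
  qed
  have tl: "tl (c (i # w)) = (if i = p then c else ggs_a p [^]\<^bsub>tree_aut p\<^esub> e i) w"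
    if "i \<in> {1..p}" "w \<in> tree_words p" for i w
    using fun_cong[OF fun_cong[OF psi, of i], of w] that by (simp add: tree_psi_def)
  have "c w = directed_map p e w" if "w \<in> tree_words p" for w
    using that
  proof (induction w)
    case Nil
    then show ?case using tree_aut_Nil[OF cA p] by simp
  next
    case (Cons i w)
    then have "i \<in> {1..p}" "w \<in> tree_words p" by simp_all
    with hd[OF this] tl[OF this] Cons.IH show ?case by (auto split: if_splits)
  qed
  moreover have "c \<in> extensional (tree_words p)"
    using cA by (simp add: tree_aut_carrier Bij_imp_extensional)
  ultimately show ?thesis
    unfolding ggs_b_def by (intro extensionalityI[OF _ restrict_extensional]) auto
qed

end

theory Submission
  imports Defs
begin

text \<open>
  Write \<open>s = e\<^sub>1 + \<dots> + e\<^sub>p\<^sub>-\<^sub>1\<close>. Every element \<open>g\<close> of a GGS-group acts on the children of a vertex \<open>v\<close>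
  by adding a constant modulo \<open>p\<close>, the label of \<open>g\<close> at \<open>v\<close>. The sum \<open>\<sigma>\<^sub>m(g)\<close> of the labels over level
  \<open>m\<close> is additive in \<open>g\<close> modulo \<open>p\<close>, because \<open>g\<close> only permutes that level. The recursion for \<open>b\<close>
  gives \<open>\<sigma>\<^sub>0(g) = \<alpha>\<close> and \<open>\<sigma>\<^sub>m(g) = s \<beta>\<close> for \<open>m \<ge> 1\<close>, where \<open>\<alpha>\<close> and \<open>\<beta>\<close> count the letters \<open>a\<close> and
  \<open>b\<close> in any word for \<open>g\<close> (\<open>level_sum_word\<close>).

  Suppose first that \<open>s\<close> vanishes modulo \<open>p\<close>. Then the group is periodic. The proof is an induction on
  the number of letters \<open>b\<close> in a word: if the word fixes level 1, its sections at level 1 have fewer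
  letters \<open>b\<close> or are powers of \<open>b\<close>; otherwise its \<open>p\<close>-th power fixes level 1, and each section of
  that power has as many letters \<open>b\<close> as the word and, as \<open>s\<close> vanishes, fixes level 1 itself
  (\<open>word_torsion\<close>).

  So a non-periodic group has \<open>s\<close> nonzero. Let \<open>g\<close> be an element for which \<open>\<sigma>\<^sub>0(g), \<dots>, \<sigma>\<^sub>n\<^sub>-\<^sub>1(g)\<close> are
  all nonzero. By induction on the level, \<open>g\<close> permutes level \<open>n - 1\<close> in a single cycle of length
  \<open>p\<^sup>n\<^sup>-\<^sup>1\<close> (\<open>level_orbit\<close>): once around the cycle, every label of the level is met once, so
  \<open>g\<close> to the power \<open>p\<^sup>n\<^sup>-\<^sup>1\<close> shifts the children of every vertex of that level by the same amount
  \<open>\<sigma>\<^sub>n\<^sub>-\<^sub>1(g)\<close>. In the quotient by the stabilizer of level \<open>n\<close>, all such elements therefore have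
  powers generating one and the same subgroup of order \<open>p\<close> (\<open>full_elements_common_power\<close>).

  Finally, if \<open>x\<close> and \<open>y\<close> generate the quotient, one of \<open>x\<close>, \<open>y\<close>, \<open>x y\<close> is of this kind
  (\<open>generating_pair_full_element\<close>). So the sets \<open>\<Sigma>\<close> of any two generating pairs share that
  subgroup of order \<open>p\<close>.
\<close>

section \<open>Shifts modulo a prime\<close>

lemma shift_orbit_bij:
  fixes h :: "nat \<Rightarrow> nat"
  assumes p: "prime p" and c: "\<not> p dvd c" and x: "x \<in> {1..p}"
    and h: "\<And>y. y \<in> {1..p} \<Longrightarrow> h y \<in> {1..p} \<and> [h y = y + c] (mod p)"
  shows "bij_betw (\<lambda>i. (h ^^ i) x) {..<p} {1..p}"
proof -
  have it: "(h ^^ i) x \<in> {1..p} \<and> [(h ^^ i) x = x + i * c] (mod p)" for i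
  proof (induction i)
    case (Suc i)
    then have "[h ((h ^^ i) x) = (h ^^ i) x + c] (mod p)" using h by blast
    also have "[(h ^^ i) x + c = x + i * c + c] (mod p)"
      using Suc by (intro cong_add) auto
    finally show ?case using Suc h by (simp add: algebra_simps)
  qed (use x in simp)
  have cop: "coprime c p"
    using prime_imp_coprime[OF p c] by (simp add: coprime_commute)
  have inj: "inj_on (\<lambda>i. (h ^^ i) x) {..<p}"
  proof (rule inj_onI)
    fix i j assume ij: "i \<in> {..<p}" "j \<in> {..<p}" "(h ^^ i) x = (h ^^ j) x"
    have "[x + i * c = x + j * c] (mod p)"
      using it[of i] it[of j] ij(3) by (simp add: cong_def)
    then have "[i = j] (mod p)"
      using cop by (simp add: cong_add_lcancel_nat cong_mult_rcancel_nat)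
    then show "i = j" using ij by (auto simp: cong_def)
  qed
  have "(\<lambda>i. (h ^^ i) x) ` {..<p} = {1..p}"
    by (rule card_subset_eq) (use it inj in \<open>auto simp: card_image\<close>)
  with inj show ?thesis by (simp add: bij_betw_def)
qed

lemma cong_imp_eq_letter:
  assumes "x \<in> {1..p}" "y \<in> {1..p}" "[x = y] (mod (p::nat))"
  shows "x = y"
  using assms by (intro mod_Suc_cycle_inj[of x p y]) (simp_all add: cong_def)

datatype generator = Rooted | Directed

section \<open>Words in the generators and their sections\<close>

locale ggs_data =
  fixes p :: nat and e :: "nat \<Rightarrow> int"
  assumes prime_p: "prime p" and e_nonneg: "\<And>x. x \<in> {1..p-1} \<Longrightarrow> 0 \<le> e x"
begin

abbreviation T where "T \<equiv> tree_aut p"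

sublocale T: group "tree_aut p" by (rule group_tree_aut)

lemma p_pos: "p \<ge> 1"
  using prime_p prime_gt_0_nat by (simp add: Suc_leI)

lemma p_gt_1: "p > 1"
  using prime_p prime_gt_1_nat by blast

lemma mult_apply: "v \<in> tree_words p \<Longrightarrow> (f \<otimes>\<^bsub>T\<^esub> g) v = g (f v)"
  by (simp add: tree_aut_mult compose_eq)

lemma one_apply: "v \<in> tree_words p \<Longrightarrow> \<one>\<^bsub>T\<^esub> v = v"
  by (simp add: tree_aut_one)

lemma pow_apply:
  assumes "f \<in> carrier T" "v \<in> tree_words p"
  shows "(f [^]\<^bsub>T\<^esub> (k::nat)) v = (f ^^ k) v"
  using assms by (induction k) (auto simp: mult_apply one_apply)

lemma aut_eqI:
  assumes "f \<in> carrier T" "g \<in> carrier T" "\<And>v. v \<in> tree_words p \<Longrightarrow> f v = g v"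
  shows "f = g"
  using assms by (intro extensionalityI[of f "tree_words p" g])
    (auto simp: tree_aut_carrier Bij_imp_extensional)

lemma funpow_closed:
  assumes "f \<in> carrier T" "v \<in> tree_words p"
  shows "(f ^^ k) v \<in> tree_words p"
  using assms by (induction k) (auto simp: tree_aut_closed)

primrec gen :: "generator \<Rightarrow> nat list \<Rightarrow> nat list" where
  "gen Rooted = ggs_a p"
| "gen Directed = ggs_b p e"

primrec word_aut :: "generator list \<Rightarrow> nat list \<Rightarrow> nat list" where
  "word_aut [] = \<one>\<^bsub>T\<^esub>"
| "word_aut (l # w) = gen l \<otimes>\<^bsub>T\<^esub> word_aut w"

lemma gen_closed: "gen l \<in> carrier T"
  using ggs_a_in_tree_aut[OF p_pos] ggs_b_in_stabilizer[OF p_pos]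
  by (cases l) (auto simp: level_stabilizer_def)

lemma word_aut_closed: "word_aut w \<in> carrier T"
  by (induction w) (auto simp: gen_closed)

lemma word_aut_append: "word_aut (u @ w) = word_aut u \<otimes>\<^bsub>T\<^esub> word_aut w"
  by (induction u) (auto simp: gen_closed word_aut_closed T.m_assoc)

lemma word_aut_power: "word_aut (concat (replicate k w)) = word_aut w [^]\<^bsub>T\<^esub> k"
proof (induction k)
  case (Suc k)
  then show ?case
    using T.nat_pow_Suc2[OF word_aut_closed[of w], of k] by (simp add: word_aut_append)
qed simp

lemma word_aut_replicate: "word_aut (replicate k l) = gen l [^]\<^bsub>T\<^esub> k"
  using word_aut_power[of k "[l]"] by (simp add: gen_closed)

text \<open>
  The four functions below describe the action of a word on the first level: a word \<open>w\<close> sends the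
  letter \<open>x\<close> to \<open>word_letter w x\<close>, and the section of \<open>w\<close> at \<open>x\<close> is again given by a word,
  \<open>section_word w x\<close>. Working with words makes the letter counts of a section available, which the
  automorphism alone does not determine.
\<close>

primrec gen_letter :: "generator \<Rightarrow> nat \<Rightarrow> nat" where
  "gen_letter Rooted x = x mod p + 1"
| "gen_letter Directed x = x"

primrec gen_section :: "generator \<Rightarrow> nat \<Rightarrow> generator list" where
  "gen_section Rooted x = []"
| "gen_section Directed x = (if x = p then [Directed] else replicate (nat (e x)) Rooted)"

primrec word_letter :: "generator list \<Rightarrow> nat \<Rightarrow> nat" where
  "word_letter [] x = x"
| "word_letter (l # w) x = word_letter w (gen_letter l x)"

primrec section_word :: "generator list \<Rightarrow> nat \<Rightarrow> generator list" where
  "section_word [] x = []"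
| "section_word (l # w) x = gen_section l x @ section_word w (gen_letter l x)"

lemma gen_letter_closed: "x \<in> {1..p} \<Longrightarrow> gen_letter l x \<in> {1..p}"
  using p_pos by (cases l) (auto simp: Suc_le_eq)

lemma gen_Cons:
  assumes "x \<in> {1..p}" "v \<in> tree_words p"
  shows "gen l (x # v) = gen_letter l x # word_aut (gen_section l x) v"
proof (cases l)
  case Rooted
  then show ?thesis using assms by (simp add: ggs_a_def one_apply)
next
  case Directed
  have "ggs_a p [^]\<^bsub>T\<^esub> e x = ggs_a p [^]\<^bsub>T\<^esub> nat (e x)" if "x \<noteq> p"
  proof -
    have "int (nat (e x)) = e x" using e_nonneg[of x] assms that by force
    then show ?thesis by (metis int_pow_int)
  qed
  then show ?thesis
    using Directed assms gen_closed[of Directed]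
    by (simp add: ggs_b_def word_aut_replicate)
qed

lemma word_aut_Cons:
  assumes "x \<in> {1..p}" "v \<in> tree_words p"
  shows "word_aut w (x # v) = word_letter w x # word_aut (section_word w x) v"
  using assms
proof (induction w arbitrary: x v)
  case (Cons l w)
  then show ?case
    using gen_letter_closed[OF Cons.prems(1), of l]
    by (simp add: mult_apply gen_Cons word_aut_append tree_aut_closed[OF word_aut_closed])
qed (simp add: one_apply)

lemma word_letter_closed: "x \<in> {1..p} \<Longrightarrow> word_letter w x \<in> {1..p}"
  by (induction w arbitrary: x) (use gen_letter_closed in auto)

lemma word_letter_cong: "[word_letter w x = x + count_list w Rooted] (mod p)"
proof (induction w arbitrary: x)
  case (Cons l w)
  have "[gen_letter l x = x + (if l = Rooted then 1 else 0)] (mod p)"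
    by (cases l) (auto simp: cong_def mod_simps)
  then have "[gen_letter l x + count_list w Rooted = x + count_list (l # w) Rooted] (mod p)"
    using cong_add[of "gen_letter l x" "x + (if l = Rooted then 1 else 0)" p
        "count_list w Rooted" "count_list w Rooted"] by (auto split: if_splits)
  then show ?case using Cons[of "gen_letter l x"] by (auto intro: cong_trans)
qed simp

lemma word_letter_append: "word_letter (u @ w) x = word_letter w (word_letter u x)"
  by (induction u arbitrary: x) auto

lemma section_word_append: "section_word (u @ w) x = section_word u x @ section_word w (word_letter u x)"
  by (induction u arbitrary: x) auto

lemma word_letter_power: "word_letter (concat (replicate k w)) x = (word_letter w ^^ k) x"
  by (induction k arbitrary: x) (auto simp: word_letter_append funpow_swap1)

text \<open>
  The section of \<open>w\<^sup>k\<close> at \<open>x\<close> is the product of the sections of \<open>w\<close> along the orbit of \<open>x\<close>. When \<open>w\<close>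
  permutes level 1 cyclically and \<open>k = p\<close>, this orbit is the whole level, so the counts become the
  sums over all letters computed in \<open>sum_count_section\<close>.
\<close>

lemma count_section_power:
  "count_list (section_word (concat (replicate k w)) x) l = (\<Sum>i<k. count_list (section_word w ((word_letter w ^^ i) x)) l)"
proof (induction k)
  case (Suc k)
  have "concat (replicate (Suc k) w) = concat (replicate k w) @ w"
    by (induction k) auto
  then have "section_word (concat (replicate (Suc k) w)) x =
      section_word (concat (replicate k w)) x @ section_word w ((word_letter w ^^ k) x)"
    by (simp only: section_word_append word_letter_power)
  then show ?case using Suc by (simp only: count_list_append sum.lessThan_Suc)
qed simp

lemma gen_letter_bij: "bij_betw (gen_letter l) {1..p} {1..p}"
proof -
  have "inj_on (gen_letter l) {1..p}"
    by (rule inj_onI, cases l) (auto dest: mod_Suc_cycle_inj[rotated 2])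
  then show ?thesis
    using gen_letter_closed by (simp add: bij_betw_def endo_inj_surj image_subset_iff)
qed

definition exponent_sum :: nat where
  "exponent_sum = (\<Sum>x\<in>{1..p-1}. nat (e x))"

lemma letters_split: "{1..p} = insert p {1..p-1}" "p \<notin> {1..p-1}"
  using p_pos by auto

lemma count_list_replicate: "count_list (replicate k x) y = (if x = y then k else 0)"
  by (induction k) auto

lemma sum_count_gen_section:
  "(\<Sum>x\<in>{1..p}. count_list (gen_section l x) Directed) = count_list [l] Directed"
  "(\<Sum>x\<in>{1..p}. count_list (gen_section l x) Rooted) = exponent_sum * count_list [l] Directed"
proof -
  have o: "count_list (gen_section Directed x) Directed = 0" "count_list (gen_section Directed x) Rooted = nat (e x)"
    if "x \<in> {1..p-1}" for x
    using that letters_split(2) by (auto simp: count_list_replicate)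
  have "(\<Sum>x\<in>{1..p-1}. count_list (gen_section Directed x) Directed) = 0"
    using o(1) by (intro sum.neutral) blast
  moreover have "(\<Sum>x\<in>{1..p-1}. count_list (gen_section Directed x) Rooted) = exponent_sum"
    unfolding exponent_sum_def by (rule sum.cong[OF refl o(2)])
  ultimately show "(\<Sum>x\<in>{1..p}. count_list (gen_section l x) Directed) = count_list [l] Directed"
    "(\<Sum>x\<in>{1..p}. count_list (gen_section l x) Rooted) = exponent_sum * count_list [l] Directed"
    unfolding letters_split(1) sum.insert[OF finite_atLeastAtMost letters_split(2)]
    by (cases l; simp)+
qed

text \<open>
  Each letter \<open>b\<close> of a word is read once from each starting letter; the letters met there run through
  all of \<open>{1..p}\<close>. It contributes one \<open>b\<close>, from the letter \<open>p\<close>, and \<open>e\<^sub>x\<close> letters \<open>a\<close> from every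
  other \<open>x\<close>.
\<close>

lemma sum_count_section:
  "(\<Sum>x\<in>{1..p}. count_list (section_word w x) Directed) = count_list w Directed"
  "(\<Sum>x\<in>{1..p}. count_list (section_word w x) Rooted) = exponent_sum * count_list w Directed"
proof (induction w)
  case (Cons l w)
  have reindex: "(\<Sum>x\<in>{1..p}. count_list (section_word w (gen_letter l x)) l') =
      (\<Sum>x\<in>{1..p}. count_list (section_word w x) l')" for l'
    by (rule sum.reindex_bij_betw[OF gen_letter_bij])
  {
    case 1 show ?case using Cons.IH sum_count_gen_section[of l] reindex
      by (simp add: sum.distrib)
  next
    case 2 show ?case using Cons.IH sum_count_gen_section[of l] reindex
      by (simp add: sum.distrib algebra_simps)
  }
qed auto

text \<open>
  A letter \<open>b\<close> of the word survives in the section exactly when it is read at \<open>p\<close>. If all of them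
  survive, none is replaced by a power of \<open>a\<close>, and nothing but letters \<open>b\<close> remains. This is the
  exceptional case of the descent in \<open>word_torsion\<close>.
\<close>

lemma count_section_le:
  "count_list (section_word w x) Directed \<le> count_list w Directed \<and>
   (count_list (section_word w x) Directed = count_list w Directed \<longrightarrow>
      section_word w x = replicate (count_list w Directed) Directed)"
proof (induction w arbitrary: x)
  case (Cons l w)
  note IH = Cons[of "gen_letter l x"]
  show ?case
  proof (cases "l = Directed \<and> x \<noteq> p")
    case True
    have "count_list (section_word w x) Directed < Suc (count_list w Directed)"
      using True IH by simp
    then show ?thesis using True by (simp add: count_list_replicate)
  next
    case False
    then show ?thesis using IH by (cases l) auto
  qed
qed simp

section \<open>Periodicity when the exponent sum vanishes\<close>

definition torsion :: "(nat list \<Rightarrow> nat list) \<Rightarrow> bool" where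
  "torsion f \<longleftrightarrow> (\<exists>m::nat. m > 0 \<and> f [^]\<^bsub>T\<^esub> m = \<one>\<^bsub>T\<^esub>)"

lemma torsion_of_power:
  assumes "f \<in> carrier T" "k > 0" "torsion (f [^]\<^bsub>T\<^esub> (k::nat))"
  shows "torsion f"
proof -
  obtain m :: nat where "m > 0" "f [^]\<^bsub>T\<^esub> (k * m) = \<one>\<^bsub>T\<^esub>"
    using assms by (auto simp: torsion_def T.nat_pow_pow)
  then show ?thesis using assms(2) unfolding torsion_def by (metis nat_0_less_mult_iff)
qed

lemma power_Cons_of_fixed_letter:
  assumes word_letter: "word_letter w x = x" and x: "x \<in> {1..p}" and v: "v \<in> tree_words p"
  shows "(word_aut w [^]\<^bsub>T\<^esub> (k::nat)) (x # v) = x # (word_aut (section_word w x) [^]\<^bsub>T\<^esub> k) v"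
  using v
proof (induction k arbitrary: v)
  case (Suc k)
  have "(word_aut (section_word w x) [^]\<^bsub>T\<^esub> k) v \<in> tree_words p"
    by (intro tree_aut_closed[OF T.nat_pow_closed[OF word_aut_closed]] Suc.prems)
  then show ?case using Suc x word_letter by (simp add: mult_apply word_aut_Cons)
qed (use x in \<open>simp add: one_apply\<close>)

lemma torsion_of_sections:
  assumes word_letter: "\<And>x. x \<in> {1..p} \<Longrightarrow> word_letter w x = x"
    and tors: "\<And>x. x \<in> {1..p} \<Longrightarrow> torsion (word_aut (section_word w x))"
  shows "torsion (word_aut w)"
proof -
  define P where "P m x \<longleftrightarrow> m > 0 \<and> word_aut (section_word w x) [^]\<^bsub>T\<^esub> m = \<one>\<^bsub>T\<^esub>" for m :: nat and x
  obtain m where m: "\<And>x. x \<in> {1..p} \<Longrightarrow> P (m x) x"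
    using tors unfolding torsion_def P_def by metis
  \<comment> \<open>A common multiple of the orders of all sections kills the word.\<close>
  define M where "M = prod m {1..p}"
  have "M > 0" using m by (auto simp: M_def P_def intro!: prod_pos)
  moreover have "word_aut w [^]\<^bsub>T\<^esub> M = \<one>\<^bsub>T\<^esub>"
  proof (rule aut_eqI)
    fix v assume v: "v \<in> tree_words p"
    show "(word_aut w [^]\<^bsub>T\<^esub> M) v = \<one>\<^bsub>T\<^esub> v"
    proof (cases v)
      case Nil
      then show ?thesis
        using tree_aut_Nil[OF T.nat_pow_closed[OF word_aut_closed] p_pos]
          tree_aut_Nil[OF T.one_closed p_pos] by simp
    next
      case (Cons x u)
      then have xu: "x \<in> {1..p}" "u \<in> tree_words p" using v by auto
      have "m x dvd M" unfolding M_def using xu by (intro dvd_prodI) auto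
      then obtain k where "M = m x * k" by blast
      then have "word_aut (section_word w x) [^]\<^bsub>T\<^esub> M = \<one>\<^bsub>T\<^esub>"
        using m[OF xu(1)] by (simp add: P_def word_aut_closed flip: T.nat_pow_pow)
      then show ?thesis using power_Cons_of_fixed_letter[OF word_letter xu] xu Cons v by (simp add: one_apply)
    qed
  qed (auto simp: word_aut_closed)
  ultimately show ?thesis by (auto simp: torsion_def)
qed

lemma word_letter_trivial:
  assumes "p dvd count_list w Rooted" "x \<in> {1..p}"
  shows "word_letter w x = x"
proof (rule cong_imp_eq_letter[OF word_letter_closed[OF assms(2)] assms(2)])
  show "[word_letter w x = x] (mod p)"
  proof (rule cong_trans[OF word_letter_cong])
    show "[x + count_list w Rooted = x] (mod p)"
      using assms(1) by (simp add: cong_add_lcancel_0_nat cong_0_iff)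
  qed
qed

lemma torsion_one: "torsion \<one>\<^bsub>T\<^esub>"
  unfolding torsion_def by (rule exI[of _ 1]) simp

lemma rooted_torsion: "torsion (ggs_a p)"
proof -
  let ?w = "concat (replicate p [Rooted])"
  have "torsion (word_aut ?w)"
  proof (rule torsion_of_sections)
    have c: "count_list ?w Rooted = p" by (simp add: count_list_replicate)
    then show "word_letter ?w x = x" if "x \<in> {1..p}" for x using word_letter_trivial that by simp
    have "section_word (replicate k Rooted) x = []" for k x by (induction k arbitrary: x) auto
    then show "torsion (word_aut (section_word ?w x))" for x by (simp add: torsion_one)
  qed
  then have "torsion (ggs_a p [^]\<^bsub>T\<^esub> p)" using gen_closed[of Rooted] by (simp add: word_aut_replicate)
  then show ?thesis by (rule torsion_of_power[rotated 2]) (use gen_closed[of Rooted] p_pos in auto)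
qed

text \<open>
  An exponent killing \<open>a\<close> also kills \<open>b\<close>: below the letters other than \<open>p\<close>, that power of \<open>b\<close> acts
  as the same power of some \<open>a\<^sup>k\<close>, hence trivially; below \<open>p\<close> it acts as itself on a shorter word.
\<close>

lemma directed_torsion: "torsion (ggs_b p e)"
proof -
  obtain m :: nat where m: "m > 0" "ggs_a p [^]\<^bsub>T\<^esub> m = \<one>\<^bsub>T\<^esub>"
    using rooted_torsion by (auto simp: torsion_def)
  have a: "ggs_a p \<in> carrier T" and b: "ggs_b p e \<in> carrier T"
    using gen_closed[of Rooted] gen_closed[of Directed] by simp_all
  have ak: "(ggs_a p [^]\<^bsub>T\<^esub> k) [^]\<^bsub>T\<^esub> m = \<one>\<^bsub>T\<^esub>" for k :: nat
  proof -
    have "(ggs_a p [^]\<^bsub>T\<^esub> k) [^]\<^bsub>T\<^esub> m = (ggs_a p [^]\<^bsub>T\<^esub> m) [^]\<^bsub>T\<^esub> k"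
      using a by (simp add: T.nat_pow_pow mult.commute)
    then show ?thesis using m by simp
  qed
  have "(ggs_b p e [^]\<^bsub>T\<^esub> m) v = \<one>\<^bsub>T\<^esub> v" if "v \<in> tree_words p" for v
    using that
  proof (induction v)
    case Nil
    show ?case
      using tree_aut_Nil[OF T.nat_pow_closed[OF b] p_pos] tree_aut_Nil[OF T.one_closed p_pos]
      by simp
  next
    case (Cons x v)
    have "(ggs_b p e [^]\<^bsub>T\<^esub> m) (x # v) = x # (word_aut (gen_section Directed x) [^]\<^bsub>T\<^esub> m) v"
      using power_Cons_of_fixed_letter[of "[Directed]" x v m] Cons.prems b by simp
    also have "word_aut (gen_section Directed x) [^]\<^bsub>T\<^esub> m =
        (if x = p then ggs_b p e [^]\<^bsub>T\<^esub> m else \<one>\<^bsub>T\<^esub>)"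
      using ak b by (simp add: word_aut_replicate)
    finally show ?case using Cons by (simp add: one_apply)
  qed
  then have "ggs_b p e [^]\<^bsub>T\<^esub> m = \<one>\<^bsub>T\<^esub>"
    using b by (intro aut_eqI) auto
  then show ?thesis using m by (auto simp: torsion_def)
qed

lemma torsion_power:
  assumes "f \<in> carrier T" "torsion f"
  shows "torsion (f [^]\<^bsub>T\<^esub> (k::nat))"
proof -
  obtain m :: nat where m: "m > 0" "f [^]\<^bsub>T\<^esub> m = \<one>\<^bsub>T\<^esub>"
    using assms by (auto simp: torsion_def)
  have "(f [^]\<^bsub>T\<^esub> k) [^]\<^bsub>T\<^esub> m = (f [^]\<^bsub>T\<^esub> m) [^]\<^bsub>T\<^esub> k"
    using assms(1) by (simp add: T.nat_pow_pow mult.commute)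
  then show ?thesis using m by (auto simp: torsion_def)
qed

text \<open>
  The fact \<open>trivial\<close> in the proof treats words fixing level 1, for all words with at most as many
  letters \<open>b\<close> as the given one. It has to allow the same number, because passing to the
  section of a \<open>p\<close>-th power in the second case keeps the number of letters \<open>b\<close> and gains only that
  the section fixes level 1; the divisibility of the exponent sum enters there.
\<close>

lemma word_torsion:
  assumes s: "p dvd exponent_sum"
  shows "torsion (word_aut w)"
proof (induction "count_list w Directed" arbitrary: w rule: less_induct)
  case less
  have trivial: "torsion (word_aut u)"
    if u: "p dvd count_list u Rooted" "count_list u Directed \<le> count_list w Directed" for u
  proof (rule torsion_of_sections)
    show "word_letter u x = x" if "x \<in> {1..p}" for x by (rule word_letter_trivial[OF u(1) that])
    show "torsion (word_aut (section_word u x))" for x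
    proof (cases "count_list (section_word u x) Directed = count_list u Directed")
      case True
      then show ?thesis
        using count_section_le[of u x] directed_torsion gen_closed[of Directed]
        by (simp add: word_aut_replicate torsion_power)
    next
      case False
      then show ?thesis using less count_section_le[of u x] u(2) by simp
    qed
  qed
  show ?case
  proof (cases "p dvd count_list w Rooted")
    case True
    then show ?thesis by (rule trivial) simp
  next
    case False
    define v where "v = concat (replicate p w)"
    have "torsion (word_aut v)"
    proof (rule torsion_of_sections)
      have c: "count_list v Rooted = p * count_list w Rooted"
        unfolding v_def by (induction p) auto
      show "word_letter v x = x" if "x \<in> {1..p}" for x
        by (rule word_letter_trivial[OF _ that]) (simp add: c)
      fix x assume x: "x \<in> {1..p}"
      have "count_list (section_word v x) l = (\<Sum>y\<in>{1..p}. count_list (section_word w y) l)" for l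
        unfolding v_def count_section_power
        by (rule sum.reindex_bij_betw[OF shift_orbit_bij[OF prime_p False x]])
          (use word_letter_closed word_letter_cong in auto)
      then show "torsion (word_aut (section_word v x))"
        using s by (intro trivial) (simp_all only: sum_count_section dvd_mult2 order_refl)
    qed
    then show ?thesis
      using torsion_of_power[OF word_aut_closed, of p w] p_pos by (simp add: v_def word_aut_power)
  qed
qed

text \<open>
  As both generators have finite order, their inverses are positive powers, so words without
  inverse letters suffice.
\<close>

lemma carrier_GGS: "carrier (GGS_group p e) = range word_aut"
proof -
  have ab: "{ggs_a p, ggs_b p e} \<subseteq> carrier T"
    using gen_closed[of Rooted] gen_closed[of Directed] by simp
  have c: "carrier (GGS_group p e) = generate T {ggs_a p, ggs_b p e}"
    using ab by (simp add: GGS_group_def carrier_subgroup_generated Int_absorb1)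
  have g: "gen l \<in> {ggs_a p, ggs_b p e}" for l by (cases l) auto
  have gw: "gen l = word_aut [l]" for l by (simp add: gen_closed)
  have inv_gen: "inv\<^bsub>T\<^esub> (gen l) \<in> range word_aut" for l
  proof -
    have "torsion (gen l)" using rooted_torsion directed_torsion by (cases l) auto
    then obtain m :: nat where m: "m > 0" "gen l [^]\<^bsub>T\<^esub> m = \<one>\<^bsub>T\<^esub>"
      by (auto simp: torsion_def)
    then have "gen l [^]\<^bsub>T\<^esub> (m - 1) \<otimes>\<^bsub>T\<^esub> gen l = \<one>\<^bsub>T\<^esub>"
      by (metis T.nat_pow_Suc Suc_diff_1)
    then have "inv\<^bsub>T\<^esub> (gen l) = gen l [^]\<^bsub>T\<^esub> (m - 1)"
      using gen_closed by (intro T.inv_equality) auto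
    then show ?thesis by (metis word_aut_replicate rangeI)
  qed
  have "generate T {ggs_a p, ggs_b p e} = range word_aut"
  proof
    show "generate T {ggs_a p, ggs_b p e} \<subseteq> range word_aut"
    proof
      fix f assume "f \<in> generate T {ggs_a p, ggs_b p e}"
      then show "f \<in> range word_aut"
      proof induction
        case one
        show ?case by (metis word_aut.simps(1) rangeI)
      next
        case (incl h)
        then obtain l where "h = gen l" by (metis gen.simps insertE singletonD)
        then show ?case using gw by (metis rangeI)
      next
        case (inv h)
        then obtain l where "h = gen l" by (metis gen.simps insertE singletonD)
        then show ?case by (simp only: inv_gen)
      next
        case (eng f g)
        then obtain u w where "f = word_aut u" "g = word_aut w" by blast
        then have "f \<otimes>\<^bsub>T\<^esub> g = word_aut (u @ w)" by (simp only: word_aut_append)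
        then show ?case by (simp only: rangeI)
      qed
    qed
    have "word_aut w \<in> generate T {ggs_a p, ggs_b p e}" for w
    proof (induction w)
      case Nil
      show ?case by (simp add: generate.one)
    next
      case (Cons l w)
      then show ?case using generate.eng[OF generate.incl[OF g]] by simp
    qed
    then show "range word_aut \<subseteq> generate T {ggs_a p, ggs_b p e}" by (rule image_subsetI)
  qed
  with c show ?thesis by simp
qed

theorem periodic_if_dvd_exponent_sum:
  assumes "p dvd exponent_sum"
  shows "periodic_group (GGS_group p e)"
  unfolding periodic_group_def
proof
  fix g assume "g \<in> carrier (GGS_group p e)"
  then have "torsion g" using word_torsion[OF assms] by (auto simp: carrier_GGS)
  then show "\<exists>m::nat. m > 0 \<and> g [^]\<^bsub>GGS_group p e\<^esub> m = \<one>\<^bsub>GGS_group p e\<^esub>"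
    by (simp add: torsion_def GGS_group_def pow_subgroup_generated)
qed


section \<open>Labels and their sums over a level\<close>

text \<open>
  A labelled automorphism sends a child \<open>v x\<close> to the child of the image of \<open>v\<close> with letter \<open>x + c\<close>
  modulo \<open>p\<close>. The constant \<open>c\<close> can be read off at the letter \<open>p\<close>, which represents zero. It is kept
  as a number in \<open>{1..p}\<close> and only matters up to congruence.
\<close>

definition label :: "(nat list \<Rightarrow> nat list) \<Rightarrow> nat list \<Rightarrow> nat" where
  "label f v = last (f (v @ [p]))"

definition cyclic_labels :: "(nat list \<Rightarrow> nat list) \<Rightarrow> bool" where
  "cyclic_labels f \<longleftrightarrow> f \<in> carrier T \<and>
     (\<forall>v\<in>tree_words p. \<forall>x\<in>{1..p}. [last (f (v @ [x])) = x + label f v] (mod p))"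

definition level_sum :: "nat \<Rightarrow> (nat list \<Rightarrow> nat list) \<Rightarrow> nat" where
  "level_sum m f = (\<Sum>v\<in>tree_level p m. label f v)"

lemma cyclic_closed: "cyclic_labels f \<Longrightarrow> f \<in> carrier T"
  by (simp add: cyclic_labels_def)

lemma cyclic_child:
  assumes f: "cyclic_labels f" and v: "v \<in> tree_words p" and x: "x \<in> {1..p}"
  obtains y where "y \<in> {1..p}" "f (v @ [x]) = f v @ [y]" "[y = x + label f v] (mod p)"
proof -
  have vx: "v @ [x] \<in> tree_words p" using v x by simp
  obtain y where y: "f (v @ [x]) = f v @ [y]"
    using tree_aut_snoc[OF cyclic_closed[OF f] p_pos vx] by blast
  have "f (v @ [x]) \<in> tree_words p" by (rule tree_aut_closed[OF cyclic_closed[OF f] vx])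
  then have "y \<in> {1..p}" using y by simp
  moreover have "[last (f (v @ [x])) = x + label f v] (mod p)"
    using f v x unfolding cyclic_labels_def by blast
  ultimately show ?thesis using that[of y] y by simp
qed

lemma level_words: "v \<in> tree_level p m \<Longrightarrow> v \<in> tree_words p"
  by (simp add: tree_level_def)

lemma level_closed: "f \<in> carrier T \<Longrightarrow> v \<in> tree_level p m \<Longrightarrow> f v \<in> tree_level p m"
  using tree_aut_closed tree_aut_length[OF _ p_pos] by (auto simp: tree_level_def)

lemma level_lists: "tree_level p m = {w. set w \<subseteq> {1..p} \<and> length w = m}"
  by (auto simp: tree_level_def tree_words_def)

lemma finite_level: "finite (tree_level p m)"
  unfolding level_lists by (rule finite_lists_length_eq) simp

lemma card_level: "card (tree_level p m) = p ^ m"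
  unfolding level_lists by (simp add: card_lists_length_eq)

lemma level_bij:
  assumes "f \<in> carrier T"
  shows "bij_betw f (tree_level p m) (tree_level p m)"
proof -
  have "inj_on f (tree_level p m)"
    using tree_aut_inj[OF assms] level_words by (blast intro: inj_onI)
  then show ?thesis
    using level_closed[OF assms] finite_level by (simp add: bij_betw_def endo_inj_surj image_subsetI)
qed

text \<open>
  The label of a product at \<open>v\<close> is the label of \<open>f\<close> at \<open>v\<close> plus the label of \<open>g\<close> at the image of \<open>v\<close>.
  Summed over a level, the second term is just reindexed, since \<open>f\<close> permutes the level.
\<close>

lemma cyclic_mult:
  assumes f: "cyclic_labels f" and g: "cyclic_labels g"
  shows "cyclic_labels (f \<otimes>\<^bsub>T\<^esub> g)"
    and "[level_sum m (f \<otimes>\<^bsub>T\<^esub> g) = level_sum m f + level_sum m g] (mod p)"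
proof -
  have last: "[last ((f \<otimes>\<^bsub>T\<^esub> g) (v @ [x])) = x + (label f v + label g (f v))] (mod p)"
    if v: "v \<in> tree_words p" and x: "x \<in> {1..p}" for v x
  proof -
    obtain y where y: "y \<in> {1..p}" "f (v @ [x]) = f v @ [y]" "[y = x + label f v] (mod p)"
      using cyclic_child[OF f v x] .
    have fv: "f v \<in> tree_words p" by (rule tree_aut_closed[OF cyclic_closed[OF f] v])
    obtain z where z: "g (f v @ [y]) = g (f v) @ [z]" "[z = y + label g (f v)] (mod p)"
      using cyclic_child[OF g fv y(1)] by blast
    have "[y + label g (f v) = x + label f v + label g (f v)] (mod p)"
      using y(3) by (rule cong_add) simp
    then have "[z = x + label f v + label g (f v)] (mod p)" by (rule cong_trans[OF z(2)])
    then show ?thesis using v x y z by (simp add: mult_apply add.assoc)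
  qed
  have lab: "[label (f \<otimes>\<^bsub>T\<^esub> g) v = label f v + label g (f v)] (mod p)"
    if v: "v \<in> tree_words p" for v
    using last[OF v, of p] p_pos by (simp add: label_def cong_def)
  show "cyclic_labels (f \<otimes>\<^bsub>T\<^esub> g)"
    unfolding cyclic_labels_def
  proof (intro conjI ballI)
    fix v x assume vx: "v \<in> tree_words p" "x \<in> {1..p}"
    show "[last ((f \<otimes>\<^bsub>T\<^esub> g) (v @ [x])) = x + label (f \<otimes>\<^bsub>T\<^esub> g) v] (mod p)"
      by (rule cong_trans[OF last[OF vx] cong_add[OF cong_refl cong_sym[OF lab[OF vx(1)]]]])
  qed (use f g in \<open>simp add: cyclic_labels_def\<close>)
  have "[level_sum m (f \<otimes>\<^bsub>T\<^esub> g) = (\<Sum>v\<in>tree_level p m. label f v + label g (f v))] (mod p)"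
    unfolding level_sum_def by (rule cong_sum) (use lab level_words in blast)
  also have "(\<Sum>v\<in>tree_level p m. label f v + label g (f v)) = level_sum m f + level_sum m g"
    unfolding level_sum_def sum.distrib
    using sum.reindex_bij_betw[OF level_bij[OF cyclic_closed[OF f]], of "label g" m] by simp
  finally show "[level_sum m (f \<otimes>\<^bsub>T\<^esub> g) = level_sum m f + level_sum m g] (mod p)" .
qed

lemma cyclic_one: "cyclic_labels \<one>\<^bsub>T\<^esub>"
  using p_pos by (auto simp: cyclic_labels_def label_def one_apply cong_def)

lemma level_sum_one: "p dvd level_sum m \<one>\<^bsub>T\<^esub>"
  using p_pos unfolding level_sum_def
  by (intro dvd_sum) (auto simp: label_def one_apply tree_level_def)

text \<open>
  Below a letter, the label of a generator is the label of its section there. This drives both the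
  proof that \<open>b\<close> has labels and the recursion for the level sums.
\<close>

lemma last_gen_Cons:
  assumes "y \<in> {1..p}" "v \<in> tree_words p" "x \<in> {1..p}"
  shows "last (gen l ((y # v) @ [x])) = last (word_aut (gen_section l y) (v @ [x]))"
proof -
  have vx: "v @ [x] \<in> tree_words p" using assms by simp
  have "word_aut (gen_section l y) (v @ [x]) \<noteq> []"
    using tree_aut_length[OF word_aut_closed p_pos vx, of "gen_section l y"] by auto
  then show ?thesis using gen_Cons[OF assms(1) vx] by simp
qed

lemma label_gen_Cons:
  assumes "y \<in> {1..p}" "v \<in> tree_words p"
  shows "label (gen l) (y # v) = label (word_aut (gen_section l y)) v"
  using last_gen_Cons[OF assms, of p l] p_pos by (simp add: label_def)

lemma gen_singleton: "x \<in> {1..p} \<Longrightarrow> gen l [x] = [gen_letter l x]"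
  using gen_Cons[of x "[]" l] tree_aut_Nil[OF word_aut_closed p_pos] by simp

lemma label_gen_Nil: "[label (gen l) [] = count_list [l] Rooted] (mod p)"
  using gen_singleton[of p l] p_pos by (cases l) (auto simp: label_def cong_def)

lemma cyclic_gen_of_sections:
  assumes "\<And>v y x. v \<in> tree_words p \<Longrightarrow> y \<in> {1..p} \<Longrightarrow> x \<in> {1..p} \<Longrightarrow>
     [last (word_aut (gen_section l y) (v @ [x])) = x + label (word_aut (gen_section l y)) v] (mod p)"
  shows "cyclic_labels (gen l)"
  unfolding cyclic_labels_def
proof (intro conjI ballI gen_closed)
  fix v x assume v: "v \<in> tree_words p" and x: "x \<in> {1..p}"
  show "[last (gen l (v @ [x])) = x + label (gen l) v] (mod p)"
  proof (cases v)
    case Nil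
    have "[gen_letter l x = x + count_list [l] Rooted] (mod p)"
      using word_letter_cong[of "[l]" x] by simp
    then have "[gen_letter l x = x + label (gen l) []] (mod p)"
      using cong_trans cong_add[OF cong_refl cong_sym[OF label_gen_Nil]] by blast
    then show ?thesis using Nil gen_singleton[OF x, of l] by simp
  next
    case (Cons y u)
    then show ?thesis
      using assms[of u y x] last_gen_Cons[of y u x l] label_gen_Cons[of y u l] v x by simp
  qed
qed

lemma cyclic_word_of_gens:
  assumes "\<And>l. l \<in> set w \<Longrightarrow> cyclic_labels (gen l)"
  shows "cyclic_labels (word_aut w)"
  using assms by (induction w) (auto intro: cyclic_one cyclic_mult(1))

lemma cyclic_gen: "cyclic_labels (gen l)"
proof -
  have one: "[last (\<one>\<^bsub>T\<^esub> (v @ [x])) = x + label \<one>\<^bsub>T\<^esub> v] (mod p)"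
    if "v \<in> tree_words p" "x \<in> {1..p}" for v x
    using cyclic_one that by (simp add: cyclic_labels_def)
  have rooted: "cyclic_labels (gen Rooted)"
    by (rule cyclic_gen_of_sections) (simp add: one)
  have power: "cyclic_labels (word_aut (replicate k Rooted))" for k
    by (rule cyclic_word_of_gens) (use rooted in \<open>auto split: if_splits\<close>)
  have directed: "[last (ggs_b p e (v @ [x])) = x + label (ggs_b p e) v] (mod p)"
    if "v \<in> tree_words p" "x \<in> {1..p}" for v x
    using that
  proof (induction v)
    case Nil
    then show ?case
      using gen_singleton[of x Directed] gen_singleton[of p Directed] p_pos
      by (simp add: label_def cong_def)
  next
    case (Cons y u)
    have eq: "word_aut (gen_section Directed y) =
        (if y = p then ggs_b p e else word_aut (replicate (nat (e y)) Rooted))"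
      using gen_closed[of Directed] by simp
    have "[last (word_aut (gen_section Directed y) (u @ [x])) = x + label (word_aut (gen_section Directed y)) u] (mod p)"
      unfolding eq using Cons power by (auto simp: cyclic_labels_def)
    then show ?case
      using last_gen_Cons[of y u x Directed] label_gen_Cons[of y u Directed] Cons.prems by simp
  qed
  show ?thesis
    using rooted directed gen_closed[of Directed] by (cases l) (auto simp: cyclic_labels_def)
qed

lemma cyclic_word: "cyclic_labels (word_aut w)"
  by (rule cyclic_word_of_gens) (rule cyclic_gen)

lemma sum_level_Suc:
  "(\<Sum>v\<in>tree_level p (Suc m). F v) = (\<Sum>y\<in>{1..p}. \<Sum>v\<in>tree_level p m. F (y # v))"
proof -
  have "bij_betw (\<lambda>(y, v). y # v) ({1..p} \<times> tree_level p m) (tree_level p (Suc m))"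
    by (rule bij_betw_byWitness[where f' = "\<lambda>v. (hd v, tl v)"])
      (auto simp: tree_level_def length_Suc_conv)
  from sum.reindex_bij_betw[OF this, of F] show ?thesis
    by (simp add: sum.cartesian_product case_prod_unfold)
qed

text \<open>
  The level sum of a generator at level \<open>m + 1\<close> is the sum of the level sums of its sections at level
  \<open>m\<close>. The sections of \<open>b\<close> together contain \<open>s\<close> letters \<open>a\<close> and one letter \<open>b\<close>: the former give
  the value \<open>s\<close> at level 1, the latter carries it on to all deeper levels.
\<close>

lemma level_sum_word:
  "[level_sum m (word_aut w) =
     (if m = 0 then count_list w Rooted else exponent_sum * count_list w Directed)] (mod p)"
  (is "[_ = ?c m w] (mod p)")
proof (induction m arbitrary: w)
  have word: "[level_sum m (word_aut w) = ?c m w] (mod p)"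
    if gens: "\<And>l. [level_sum m (gen l) = ?c m [l]] (mod p)" for m w
  proof (induction w)
    case Nil
    show ?case using level_sum_one by (simp add: cong_0_iff)
  next
    case (Cons l w)
    have "?c m (l # w) = ?c m [l] + ?c m w" by (simp add: algebra_simps)
    then show ?case
      using cong_trans[OF cyclic_mult(2)[OF cyclic_gen cyclic_word] cong_add[OF gens Cons]]
      by simp
  qed
  {
    case 0
    have "tree_level p 0 = {[]}" by (auto simp: tree_level_def)
    then show ?case using label_gen_Nil by (intro word) (simp add: level_sum_def)
  next
    case (Suc m)
    have "[level_sum (Suc m) (gen l) = ?c (Suc m) [l]] (mod p)" for l
    proof -
      have "level_sum (Suc m) (gen l) = (\<Sum>y\<in>{1..p}. level_sum m (word_aut (gen_section l y)))"
        unfolding level_sum_def sum_level_Suc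
        by (intro sum.cong refl) (use label_gen_Cons level_words in auto)
      also have "[\<dots> = (\<Sum>y\<in>{1..p}. ?c m (gen_section l y))] (mod p)"
        by (intro cong_sum Suc)
      also have "(\<Sum>y\<in>{1..p}. ?c m (gen_section l y)) = ?c (Suc m) [l]"
        using sum_count_gen_section[of l] by (cases "m = 0") (simp_all flip: sum_distrib_left)
      finally show ?thesis .
    qed
    then show ?case by (rule word)
  }
qed


section \<open>Elements acting on a level as one cycle\<close>

lemma funpow_child:
  assumes f: "cyclic_labels f" and v: "v \<in> tree_words p" and x: "x \<in> {1..p}"
  shows "\<exists>y\<in>{1..p}. (f ^^ k) (v @ [x]) = (f ^^ k) v @ [y] \<and>
    [y = x + (\<Sum>j<k. label f ((f ^^ j) v))] (mod p)"
proof (induction k)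
  case (Suc k)
  then obtain y where y: "y \<in> {1..p}" "(f ^^ k) (v @ [x]) = (f ^^ k) v @ [y]"
    "[y = x + (\<Sum>j<k. label f ((f ^^ j) v))] (mod p)" by blast
  obtain z where z: "z \<in> {1..p}" "f ((f ^^ k) v @ [y]) = f ((f ^^ k) v) @ [z]"
    "[z = y + label f ((f ^^ k) v)] (mod p)"
    using cyclic_child[OF f funpow_closed[OF cyclic_closed[OF f] v, of k] y(1)] .
  have "[y + label f ((f ^^ k) v) = x + (\<Sum>j<k. label f ((f ^^ j) v)) + label f ((f ^^ k) v)] (mod p)"
    using y(3) by (rule cong_add) simp
  then have "[z = x + (\<Sum>j<Suc k. label f ((f ^^ j) v))] (mod p)"
    using cong_trans[OF z(3)] by (simp add: add.assoc)
  moreover have "(f ^^ Suc k) (v @ [x]) = (f ^^ Suc k) v @ [z]"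
    using y(2) z(2) by simp
  ultimately show ?case using z(1) by blast
qed (use x in auto)

text \<open>
  During one turn of the cycle through level \<open>m\<close> every vertex is visited once, so a child picks up
  the sum of all labels of the level, whatever vertex one starts from.
\<close>

lemma return_shifts_children:
  assumes f: "cyclic_labels f" and u: "u \<in> tree_level p m" and x: "x \<in> {1..p}"
    and orbit: "bij_betw (\<lambda>k. (f ^^ k) u) {..<p ^ m} (tree_level p m)" "(f ^^ (p ^ m)) u = u"
  shows "\<exists>y\<in>{1..p}. (f ^^ (p ^ m * t)) (u @ [x]) = u @ [y] \<and> [y = x + t * level_sum m f] (mod p)"
proof (induction t)
  case (Suc t)
  then obtain y where y: "y \<in> {1..p}" "(f ^^ (p ^ m * t)) (u @ [x]) = u @ [y]"
    "[y = x + t * level_sum m f] (mod p)" by blast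
  have "(\<Sum>j<p ^ m. label f ((f ^^ j) u)) = level_sum m f"
    unfolding level_sum_def by (rule sum.reindex_bij_betw[OF orbit(1)])
  then obtain z where z: "z \<in> {1..p}" "(f ^^ (p ^ m)) (u @ [y]) = u @ [z]"
    "[z = y + level_sum m f] (mod p)"
    using funpow_child[OF f level_words[OF u] y(1), of "p ^ m"] orbit(2) by auto
  have "[y + level_sum m f = x + t * level_sum m f + level_sum m f] (mod p)"
    using y(3) by (rule cong_add) simp
  then have "[z = x + Suc t * level_sum m f] (mod p)"
    using cong_trans[OF z(3)] by (simp add: ac_simps)
  moreover have "(f ^^ (p ^ m * Suc t)) (u @ [x]) = u @ [z]"
    using y(2) z(2) by (simp only: mult_Suc_right funpow_add o_apply)
  ultimately show ?case using z(1) by blast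
qed (use x in auto)

lemma shift_reaches:
  assumes "\<not> p dvd c"
  shows "\<exists>t. [x + t * c = z] (mod p)"
proof -
  obtain i where i: "[c * i = 1] (mod p)"
    using cong_solve_coprime_nat[of c p] prime_imp_coprime[OF prime_p assms]
    by (auto simp: coprime_commute)
  \<comment> \<open>On natural numbers, \<open>x * (p - 1)\<close> stands for \<open>-x\<close> modulo \<open>p\<close>.\<close>
  have p: "x * (p - 1) + x = x * p"
    using p_pos by (cases p) simp_all
  have "[c * i * (z + x * (p - 1)) = 1 * (z + x * (p - 1))] (mod p)"
    using i by (rule cong_mult) simp
  then have "[x + c * i * (z + x * (p - 1)) = x + 1 * (z + x * (p - 1))] (mod p)"
    by (rule cong_add[OF cong_refl])
  also have "x + 1 * (z + x * (p - 1)) = z + x * p"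
    using p by simp
  also have "[z + x * p = z] (mod p)" by (simp add: cong_def)
  finally have "[x + i * (z + x * (p - 1)) * c = z] (mod p)" by (simp only: ac_simps)
  then show ?thesis ..
qed

text \<open>
  In the induction step, the return to a vertex \<open>u\<close> of level \<open>m\<close> shifts its \<open>p\<close> children by the
  nonzero level sum, hence permutes them in a single cycle; this multiplies the length of the cycle
  by \<open>p\<close>.
\<close>

lemma level_orbit:
  assumes f: "cyclic_labels f" and nz: "\<And>i. i < m \<Longrightarrow> \<not> p dvd level_sum i f"
    and v: "v \<in> tree_level p m"
  shows "bij_betw (\<lambda>k. (f ^^ k) v) {..<p ^ m} (tree_level p m) \<and> (f ^^ (p ^ m)) v = v"
  using nz v
proof (induction m arbitrary: v)
  case 0
  then have "v = []" "tree_level p 0 = {[]}" by (auto simp: tree_level_def)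
  then show ?case using tree_aut_Nil[OF cyclic_closed[OF f] p_pos] by (simp add: bij_betw_def lessThan_Suc)
next
  case (Suc m)
  have split: "\<exists>u x. w = u @ [x] \<and> u \<in> tree_level p m \<and> x \<in> {1..p}"
    if "w \<in> tree_level p (Suc m)" for w
    using that by (cases w rule: rev_cases) (auto simp: tree_level_def)
  obtain u x where ux: "v = u @ [x]" "u \<in> tree_level p m" "x \<in> {1..p}"
    using split[OF Suc.prems(2)] by blast
  have IH: "bij_betw (\<lambda>k. (f ^^ k) u) {..<p ^ m} (tree_level p m)" "(f ^^ (p ^ m)) u = u"
    if "u \<in> tree_level p m" for u
    using Suc.IH[OF _ that] Suc.prems(1) by auto
  note shift = return_shifts_children[OF f _ _ IH]
  have period: "(f ^^ (p ^ Suc m)) v = v"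
  proof -
    obtain y where y: "y \<in> {1..p}" "(f ^^ (p ^ m * p)) v = u @ [y]"
      "[y = x + p * level_sum m f] (mod p)"
      using shift[OF ux(2,3) ux(2) ux(2), of p] ux(1) by blast
    have "[y = x] (mod p)" using y(3) by (simp add: cong_def)
    then have "y = x" using cong_imp_eq_letter y(1) ux(3) by blast
    then show ?thesis using y(2) ux(1) by (simp add: mult.commute)
  qed
  have surj: "\<exists>j. (f ^^ j) v = w" if w: "w \<in> tree_level p (Suc m)" for w
  proof -
    obtain u' z where uz: "w = u' @ [z]" "u' \<in> tree_level p m" "z \<in> {1..p}"
      using split[OF w] by blast
    obtain k where k: "(f ^^ k) u = u'"
    proof -
      have "u' \<in> (\<lambda>k. (f ^^ k) u) ` {..<p ^ m}"
        using bij_betw_imp_surj_on[OF IH(1)[OF ux(2)]] uz(2) by simp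
      then show ?thesis using that by blast
    qed
    obtain y where y: "y \<in> {1..p}" "(f ^^ k) v = u' @ [y]"
      using funpow_child[OF f level_words[OF ux(2)] ux(3), of k] k ux(1) by blast
    obtain t where t: "[y + t * level_sum m f = z] (mod p)"
      using shift_reaches Suc.prems(1) by blast
    obtain z' where z': "z' \<in> {1..p}" "(f ^^ (p ^ m * t)) (u' @ [y]) = u' @ [z']"
      "[z' = y + t * level_sum m f] (mod p)"
      using shift[OF uz(2) y(1) uz(2) uz(2), of t] by blast
    have "z' = z" using cong_imp_eq_letter[OF z'(1) uz(3) cong_trans[OF z'(3) t]] .
    then have "(f ^^ (p ^ m * t + k)) v = w" using y z' uz(1) by (simp add: funpow_add)
    then show ?thesis by blast
  qed
  have "(\<lambda>k. (f ^^ k) v) ` {..<p ^ Suc m} = tree_level p (Suc m)"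
  proof
    have "(f ^^ k) v \<in> tree_level p (Suc m)" for k
      using Suc.prems(2) level_closed[OF cyclic_closed[OF f]] by (induction k) auto
    then show "(\<lambda>k. (f ^^ k) v) ` {..<p ^ Suc m} \<subseteq> tree_level p (Suc m)" by blast
    show "tree_level p (Suc m) \<subseteq> (\<lambda>k. (f ^^ k) v) ` {..<p ^ Suc m}"
    proof
      fix w assume "w \<in> tree_level p (Suc m)"
      then obtain j where j: "(f ^^ j) v = w" using surj by blast
      then have "(f ^^ (j mod p ^ Suc m)) v = w" using funpow_mod_eq[OF period] by simp
      moreover have "j mod p ^ Suc m < p ^ Suc m"
        using p_pos by (intro mod_less_divisor) auto
      ultimately show "w \<in> (\<lambda>k. (f ^^ k) v) ` {..<p ^ Suc m}" by blast
    qed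
  qed
  then have "bij_betw (\<lambda>k. (f ^^ k) v) {..<p ^ Suc m} (tree_level p (Suc m))"
    unfolding bij_betw_def by (intro conjI eq_card_imp_inj_on) (simp_all add: card_level)
  then show ?case using period by blast
qed

section \<open>Generating pairs of the level quotients\<close>

abbreviation G where "G \<equiv> GGS_group p e"
abbreviation St where "St \<equiv> GGS_stabilizer p e"

lemma subgroup_G: "subgroup (carrier G) T"
  unfolding GGS_group_def carrier_subgroup_generated by (rule T.generate_is_subgroup) simp

lemma G_eq: "G = T\<lparr>carrier := carrier G\<rparr>"
  by (simp add: GGS_group_def subgroup_generated_def)

lemma G_simps:
  "f \<otimes>\<^bsub>G\<^esub> g = f \<otimes>\<^bsub>T\<^esub> g" "\<one>\<^bsub>G\<^esub> = \<one>\<^bsub>T\<^esub>" "f [^]\<^bsub>G\<^esub> (k::nat) = f [^]\<^bsub>T\<^esub> k"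
  by (simp_all add: GGS_group_def pow_subgroup_generated)

lemma stabilizer_normal: "St n \<lhd> G"
  using T.normal_Int_subgroup[OF subgroup_G level_stabilizer_normal[OF p_pos, of n]] G_eq
  by (simp add: GGS_stabilizer_def)

sublocale G: group "GGS_group p e"
  using T.subgroup_imp_group[OF subgroup_G] G_eq by simp

lemma cyclic_G: "g \<in> carrier G \<Longrightarrow> cyclic_labels g"
  using cyclic_word by (auto simp: carrier_GGS)

lemma dvd_level_sum_mult:
  assumes "f \<in> carrier G" "g \<in> carrier G"
  shows "p dvd level_sum m (f \<otimes>\<^bsub>G\<^esub> g) \<longleftrightarrow> p dvd level_sum m f + level_sum m g"
  using cyclic_mult(2)[OF cyclic_G cyclic_G, of f g m] assms
  by (simp add: G_simps cong_dvd_iff)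

lemma level_sum_kernel: "subgroup {g \<in> carrier G. p dvd level_sum m g} G"
proof (rule G.subgroupI)
  have "\<one>\<^bsub>G\<^esub> \<in> {g \<in> carrier G. p dvd level_sum m g}"
    using level_sum_one G.one_closed by (simp add: G_simps)
  then show "{g \<in> carrier G. p dvd level_sum m g} \<noteq> {}" by blast
  fix f assume f: "f \<in> {g \<in> carrier G. p dvd level_sum m g}"
  then have "p dvd level_sum m f + level_sum m (inv\<^bsub>G\<^esub> f)"
    using dvd_level_sum_mult[of f "inv\<^bsub>G\<^esub> f" m] level_sum_one[of m] by (simp add: G_simps(2))
  then show "inv\<^bsub>G\<^esub> f \<in> {g \<in> carrier G. p dvd level_sum m g}"
    using f by (simp add: dvd_add_right_iff)
qed (auto simp: dvd_level_sum_mult)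

text \<open>
  Consequently the level sums for \<open>m < n\<close> are well defined on the quotient by the stabilizer.
\<close>

lemma level_sum_stabilizer:
  assumes g: "g \<in> St n" and m: "m < n"
  shows "p dvd level_sum m g"
  unfolding level_sum_def
proof (rule dvd_sum)
  fix v assume v: "v \<in> tree_level p m"
  have gT: "g \<in> carrier T" and fixed: "\<And>w. w \<in> tree_level p n \<Longrightarrow> g w = w"
    using g by (auto simp: GGS_stabilizer_def level_stabilizer_def)
  have prefix: "\<exists>w'. g (u @ w) = g u @ w'" if "u @ w \<in> tree_words p" for u w
    using that
  proof (induction w rule: rev_induct)
    case (snoc x w)
    then have "u @ w \<in> tree_words p" by simp
    from snoc.IH[OF this] obtain w' where "g (u @ w) = g u @ w'" by blast
    moreover obtain y where "g ((u @ w) @ [x]) = g (u @ w) @ [y]"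
      using tree_aut_snoc[OF gT p_pos, of "u @ w" x] snoc.prems by auto
    ultimately show ?case by simp
  qed simp
  \<comment> \<open>Fixing a vertex of level \<open>n\<close> below \<open>v @ [p]\<close> forces fixing its prefix \<open>v @ [p]\<close>.\<close>
  define w where "w = replicate (n - m - 1) p"
  have w: "(v @ [p]) @ w \<in> tree_level p n"
    using v m p_pos by (auto simp: w_def tree_level_def tree_words_def)
  have vp: "v @ [p] \<in> tree_words p" using v p_pos by (simp add: tree_level_def)
  obtain w' where w': "g ((v @ [p]) @ w) = g (v @ [p]) @ w'"
    using prefix[of "v @ [p]" w] level_words[OF w] by blast
  have "(v @ [p]) @ w = g (v @ [p]) @ w'" using fixed[OF w] w' by metis
  moreover have "length (g (v @ [p])) = length (v @ [p])" by (rule tree_aut_length[OF gT p_pos vp])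
  ultimately have "g (v @ [p]) = v @ [p]" using append_eq_append_conv by metis
  then show "p dvd label g v" by (simp add: label_def)
qed

text \<open>
  A level sum that vanishes on both generators vanishes on the subgroup they generate together with
  the stabilizer, that is, on the whole group.
\<close>

lemma generators_level_sum_nonzero:
  assumes m: "m < n" and g: "g \<in> carrier G" "\<not> p dvd level_sum m g"
    and xy: "x \<in> carrier G" "y \<in> carrier G"
    and gen: "generate (G Mod St n) {St n #>\<^bsub>G\<^esub> x, St n #>\<^bsub>G\<^esub> y} = carrier (G Mod St n)"
  shows "\<not> p dvd level_sum m x \<or> \<not> p dvd level_sum m y"
proof (rule ccontr)
  assume neg: "\<not> ?thesis"
  interpret S: normal "St n" G by (rule stabilizer_normal)
  define K where "K = {g \<in> carrier G. p dvd level_sum m g}"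
  interpret K: subgroup K G unfolding K_def by (rule level_sum_kernel)
  have SK: "St n \<subseteq> K"
  proof
    fix g assume g: "g \<in> St n"
    show "g \<in> K" unfolding K_def using S.mem_carrier[OF g] level_sum_stabilizer[OF g m] by simp
  qed
  have xyK: "x \<in> K" "y \<in> K" using neg xy unfolding K_def by simp_all
  have coset: "St n #>\<^bsub>G\<^esub> h \<subseteq> K" if "h \<in> K" for h
  proof
    fix g assume "g \<in> St n #>\<^bsub>G\<^esub> h"
    then obtain k where "k \<in> St n" "g = k \<otimes>\<^bsub>G\<^esub> h" by (auto simp: r_coset_def)
    then show "g \<in> K" using K.m_closed[OF subsetD[OF SK] that] by simp
  qed
  have coset_carrier: "St n #>\<^bsub>G\<^esub> h \<in> carrier (G Mod St n)" if "h \<in> carrier G" for h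
    unfolding FactGroup_def using G.rcosetsI[OF S.subset that] by simp
  have "Z \<subseteq> K" if "Z \<in> generate (G Mod St n) {St n #>\<^bsub>G\<^esub> x, St n #>\<^bsub>G\<^esub> y}" for Z
    using that
  proof induction
    case one
    then show ?case using SK by simp
  next
    case (incl Z)
    then show ?case using coset[OF xyK(1)] coset[OF xyK(2)] by (elim insertE emptyE) simp_all
  next
    case (inv Z)
    then obtain h where h: "Z = St n #>\<^bsub>G\<^esub> h" "h \<in> K"
      by (elim insertE emptyE) (rule that[OF _ xyK(1)] that[OF _ xyK(2)], assumption)+
    have hG: "h \<in> carrier G" using K.mem_carrier[OF h(2)] .
    have "inv\<^bsub>G Mod St n\<^esub> Z = St n #>\<^bsub>G\<^esub> (inv\<^bsub>G\<^esub> h)"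
      unfolding h(1) S.inv_FactGroup[OF coset_carrier[OF hG]] by (rule S.rcos_inv[OF hG])
    then show ?case using coset[OF K.m_inv_closed[OF h(2)]] by simp
  next
    case (eng Z1 Z2)
    have "Z1 <#>\<^bsub>G\<^esub> Z2 \<subseteq> K"
    proof
      fix g assume "g \<in> Z1 <#>\<^bsub>G\<^esub> Z2"
      then obtain g1 g2 where "g1 \<in> Z1" "g2 \<in> Z2" "g = g1 \<otimes>\<^bsub>G\<^esub> g2"
        unfolding set_mult_def by blast
      then show "g \<in> K" using eng.IH K.m_closed by (simp add: subset_iff)
    qed
    then show ?case by (simp add: FactGroup_def)
  qed
  then have "St n #>\<^bsub>G\<^esub> g \<subseteq> K" using coset_carrier[OF g(1)] gen by simp
  then have "g \<in> K" using G.rcos_self[OF g(1) S.subgroup_axioms] by (rule subsetD)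
  then show False using g(2) unfolding K_def by simp
qed

lemma level_sum_Suc_iff:
  assumes "g \<in> carrier G"
  shows "p dvd level_sum (Suc m) g \<longleftrightarrow> p dvd level_sum 1 g"
proof -
  obtain w where w: "g = word_aut w" using assms by (auto simp: carrier_GGS)
  have "p dvd level_sum (Suc k) g \<longleftrightarrow> p dvd exponent_sum * count_list w Directed" for k
    using cong_dvd_iff[OF level_sum_word[of "Suc k" w]] w by simp
  then show ?thesis by (simp only: One_nat_def)
qed

lemma level_sum_nonzero_exists:
  assumes "\<not> p dvd exponent_sum"
  shows "\<exists>g\<in>carrier G. \<not> p dvd level_sum m g"
proof -
  define w where "w = (if m = 0 then [Rooted] else [Directed])"
  have "\<not> p dvd level_sum m (word_aut w)"
    unfolding cong_dvd_iff[OF level_sum_word[of m w]] using assms p_gt_1 by (simp add: w_def)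
  then show ?thesis by (auto simp: carrier_GGS)
qed

text \<open>
  By \<open>level_sum_Suc_iff\<close> only the levels 0 and 1 matter, and only level 0 if \<open>n = 1\<close>. At a level that
  matters, the sum does not vanish on both generators. So if \<open>x\<close> and \<open>y\<close> both have a vanishing sum
  there, it vanishes at level 0 for one of them and at level 1 for the other, and the sums that are
  left are nonzero; both then survive in \<open>x y\<close>.
\<close>

lemma generating_pair_full_element:
  assumes s: "\<not> p dvd exponent_sum" and xy: "x \<in> carrier G" "y \<in> carrier G" and n: "n \<ge> 1"
    and gen: "generate (G Mod St n) {St n #>\<^bsub>G\<^esub> x, St n #>\<^bsub>G\<^esub> y} = carrier (G Mod St n)"
  shows "\<exists>z\<in>{x, y, x \<otimes>\<^bsub>G\<^esub> y}. \<forall>m<n. \<not> p dvd level_sum m z"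
proof -
  have nz: "\<not> p dvd level_sum m x \<or> \<not> p dvd level_sum m y" if "m < n" for m
  proof -
    obtain g where "g \<in> carrier G" "\<not> p dvd level_sum m g" using level_sum_nonzero_exists[OF s] ..
    then show ?thesis by (rule generators_level_sum_nonzero[OF that _ _ xy gen])
  qed
  define D where "D m z \<longleftrightarrow> p dvd level_sum m z" for m z
  have full: "\<forall>m<n. \<not> p dvd level_sum m z"
    if z: "z \<in> carrier G" "\<not> D 0 z" "1 < n \<longrightarrow> \<not> D 1 z" for z
  proof (intro allI impI)
    fix m assume m: "m < n"
    show "\<not> p dvd level_sum m z"
    proof (cases m)
      case 0
      then show ?thesis using z(2) unfolding D_def by blast
    next
      case (Suc k)
      then show ?thesis using z(3) m unfolding D_def Suc level_sum_Suc_iff[OF z(1)] by linarith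
    qed
  qed
  have prod: "\<not> D m (x \<otimes>\<^bsub>G\<^esub> y)" if "D m x \<noteq> D m y" for m
    using that unfolding D_def dvd_level_sum_mult[OF xy]
    by (cases "p dvd level_sum m x") (simp_all add: dvd_add_right_iff dvd_add_left_iff)
  have "\<not> D 0 x \<or> \<not> D 0 y" "1 < n \<longrightarrow> \<not> D 1 x \<or> \<not> D 1 y"
    using nz[of 0] nz[of 1] n unfolding D_def by auto
  then have "\<exists>z\<in>{x, y, x \<otimes>\<^bsub>G\<^esub> y}. \<not> D 0 z \<and> (1 < n \<longrightarrow> \<not> D 1 z)"
    using prod[of 0] prod[of 1] by (simp only: bex_simps) argo
  then obtain z where z: "z \<in> {x, y, x \<otimes>\<^bsub>G\<^esub> y}" "\<not> D 0 z" "1 < n \<longrightarrow> \<not> D 1 z"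
    by (elim bexE conjE)
  then have "z \<in> carrier G" using xy by (elim insertE emptyE) simp_all
  then show ?thesis by (rule bexI[OF full z(1)]) (rule z(2,3))+
qed

text \<open>
  With \<open>n = m + 1\<close>, the power \<open>p\<^sup>m\<close> of either element shifts the children of all vertices of level \<open>m\<close>
  by a nonzero constant. A multiple of one constant is the other, so suitable powers agree on level \<open>n\<close>.
\<close>

lemma full_elements_common_power:
  assumes y: "y \<in> carrier G" "\<forall>m<n. \<not> p dvd level_sum m y"
    and z: "z \<in> carrier G" "\<forall>m<n. \<not> p dvd level_sum m z" and n: "n \<ge> 1"
  shows "\<exists>(j::nat) (k::nat). St n #>\<^bsub>G\<^esub> (y [^]\<^bsub>G\<^esub> j) = St n #>\<^bsub>G\<^esub> (z [^]\<^bsub>G\<^esub> k) \<and>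
    St n #>\<^bsub>G\<^esub> (z [^]\<^bsub>G\<^esub> k) \<noteq> St n"
proof -
  interpret S: normal "St n" G by (rule stabilizer_normal)
  obtain m where m: "n = Suc m" using n by (cases n) auto
  have shift: "\<exists>x'\<in>{1..p}. (g [^]\<^bsub>G\<^esub> (p ^ m * t)) (v @ [x]) = v @ [x'] \<and>
      [x' = x + t * level_sum m g] (mod p)"
    if g: "g \<in> carrier G" "\<forall>m<n. \<not> p dvd level_sum m g"
      and v: "v \<in> tree_level p m" and x: "x \<in> {1..p}" for g t v x
  proof -
    have vx: "v @ [x] \<in> tree_words p" using level_words[OF v] x by simp
    have orbit: "bij_betw (\<lambda>k. (g ^^ k) v) {..<p ^ m} (tree_level p m) \<and> (g ^^ (p ^ m)) v = v"
      by (rule level_orbit[OF cyclic_G[OF g(1)] _ v]) (use g(2) m in simp)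
    show ?thesis
      unfolding G_simps pow_apply[OF cyclic_closed[OF cyclic_G[OF g(1)]] vx]
      by (rule return_shifts_children[OF cyclic_G[OF g(1)] v x conjunct1[OF orbit] conjunct2[OF orbit]])
  qed
  obtain t where t: "[0 + t * level_sum m y = level_sum m z] (mod p)"
    using shift_reaches[of "level_sum m y" 0] y(2) m by auto
  \<comment> \<open>The factor \<open>1\<close> puts the exponent of \<open>z\<close> into the form treated by \<open>shift\<close>.\<close>
  define Y where "Y = y [^]\<^bsub>G\<^esub> (p ^ m * t)"
  define Z where "Z = z [^]\<^bsub>G\<^esub> (p ^ m * 1)"
  have YZ: "Y \<in> carrier G" "Z \<in> carrier G" using y z by (simp_all add: Y_def Z_def)
  have eq: "Y w = Z w" if w: "w \<in> tree_level p n" for w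
  proof -
    obtain v x where vx: "w = v @ [x]" "v \<in> tree_level p m" "x \<in> {1..p}"
      using w m by (cases w rule: rev_cases) (auto simp: tree_level_def)
    obtain x1 where x1: "x1 \<in> {1..p}" "Y w = v @ [x1]" "[x1 = x + t * level_sum m y] (mod p)"
      using shift[OF y vx(2,3), of t] unfolding Y_def vx(1) by (elim bexE conjE)
    obtain x2 where x2: "x2 \<in> {1..p}" "Z w = v @ [x2]" "[x2 = x + 1 * level_sum m z] (mod p)"
      using shift[OF z vx(2,3), of 1] unfolding Z_def vx(1) by (elim bexE conjE)
    have "[x + t * level_sum m y = x + 1 * level_sum m z] (mod p)"
      using t by (simp add: cong_add_lcancel_nat)
    from cong_trans[OF cong_trans[OF x1(3) this] cong_sym[OF x2(3)]]
    have "x1 = x2" by (rule cong_imp_eq_letter[OF x1(1) x2(1)])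
    then show ?thesis using x1(2) x2(2) by simp
  qed
  define k where "k = Y \<otimes>\<^bsub>G\<^esub> inv\<^bsub>G\<^esub> Z"
  have k: "k \<in> carrier G" using YZ by (simp add: k_def)
  have "k \<in> St n"
    unfolding GGS_stabilizer_def level_stabilizer_def
  proof (intro IntI CollectI conjI ballI k)
    show "k \<in> carrier T" using cyclic_closed[OF cyclic_G[OF k]] .
    fix w assume w: "w \<in> tree_level p n"
    have "k w = (Z \<otimes>\<^bsub>G\<^esub> inv\<^bsub>G\<^esub> Z) w"
      unfolding k_def G_simps mult_apply[OF level_words[OF w]] eq[OF w] ..
    also have "\<dots> = w"
      unfolding G.r_inv[OF YZ(2)] using level_words[OF w] by (simp add: G_simps(2) one_apply)
    finally show "k w = w" .
  qed
  then have "k \<otimes>\<^bsub>G\<^esub> Z \<in> St n #>\<^bsub>G\<^esub> Z" by (rule G.rcosI[OF _ S.subset YZ(2)])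
  moreover have "k \<otimes>\<^bsub>G\<^esub> Z = Y" using YZ by (simp add: k_def G.m_assoc)
  ultimately have "Y \<in> St n #>\<^bsub>G\<^esub> Z" by simp
  then have "St n #>\<^bsub>G\<^esub> Y = St n #>\<^bsub>G\<^esub> Z"
    using G.repr_independence[OF _ YZ(2) S.subgroup_axioms] by simp
  moreover have "St n #>\<^bsub>G\<^esub> Z \<noteq> St n"
  proof
    assume "St n #>\<^bsub>G\<^esub> Z = St n"
    then have ZS: "Z \<in> St n" using G.rcos_self[OF YZ(2) S.subgroup_axioms] by simp
    define v where "v = replicate m p"
    have v: "v \<in> tree_level p m" "v @ [p] \<in> tree_level p n" "p \<in> {1..p}"
      using p_pos m by (auto simp: v_def tree_level_def tree_words_def)
    obtain x where x: "x \<in> {1..p}" "Z (v @ [p]) = v @ [x]" "[x = p + 1 * level_sum m z] (mod p)"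
      using shift[OF z v(1,3), of 1] unfolding Z_def by (elim bexE conjE)
    have "Z (v @ [p]) = v @ [p]"
      using ZS v(2) unfolding GGS_stabilizer_def level_stabilizer_def by simp
    then have "[p = p + level_sum m z] (mod p)" using x(2,3) by simp
    then have "p dvd level_sum m z" by (simp add: cong_def dvd_eq_mod_eq_0)
    then show False using z(2) m by blast
  qed
  ultimately have "St n #>\<^bsub>G\<^esub> Y = St n #>\<^bsub>G\<^esub> Z \<and> St n #>\<^bsub>G\<^esub> Z \<noteq> St n" by (rule conjI)
  then show ?thesis unfolding Y_def Z_def by - (rule exI, rule exI, assumption)
qed

lemma quotient_not_beauville:
  assumes s: "\<not> p dvd exponent_sum" and n: "n \<ge> 1"
  shows "\<not> beauville_group (G Mod St n)"
proof
  define H where "H = G Mod St n"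
  define q where "q g = St n #>\<^bsub>G\<^esub> g" for g
  assume "beauville_group (G Mod St n)"
  then have "beauville_group H" by (simp only: H_def)
  then obtain X1 Y1 X2 Y2 where gens:
      "X1 \<in> carrier H" "Y1 \<in> carrier H" "generate H {X1, Y1} = carrier H"
      "X2 \<in> carrier H" "Y2 \<in> carrier H" "generate H {X2, Y2} = carrier H"
    and disj: "beauville_Sigma H X1 Y1 \<inter> beauville_Sigma H X2 Y2 = {\<one>\<^bsub>H\<^esub>}"
    unfolding beauville_group_def by (elim conjE bexE)
  have rep: "\<exists>x\<in>carrier G. X = q x" if "X \<in> carrier H" for X
    using that unfolding H_def q_def FactGroup_def RCOSETS_def by simp
  interpret S: normal "St n" G by (rule stabilizer_normal)
  interpret H: group H unfolding H_def by (rule S.factorgroup_is_group)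
  have hom: "q \<in> hom G H" unfolding q_def H_def by (rule S.r_coset_hom_Mod)
  interpret q: group_hom G H q by unfold_locales (rule hom)
  have full: "\<exists>z\<in>carrier G. (\<forall>m<n. \<not> p dvd level_sum m z) \<and>
      (\<forall>k::nat. q (z [^]\<^bsub>G\<^esub> k) \<in> beauville_Sigma H X Y)"
    if XY: "X \<in> carrier H" "Y \<in> carrier H" "generate H {X, Y} = carrier H" for X Y
  proof -
    obtain x y where xy: "x \<in> carrier G" "y \<in> carrier G" "X = q x" "Y = q y"
      using rep[OF XY(1)] rep[OF XY(2)] by (elim bexE)
    obtain z where z: "z \<in> {x, y, x \<otimes>\<^bsub>G\<^esub> y}" "\<forall>m<n. \<not> p dvd level_sum m z"
      using generating_pair_full_element[OF s xy(1,2) n] XY(3)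
      unfolding xy(3,4) q_def H_def by (elim bexE meta_impE)
    have zG: "z \<in> carrier G" using z(1) xy(1,2) by (elim insertE emptyE) simp_all
    have "q (z [^]\<^bsub>G\<^esub> k) \<in> beauville_Sigma H X Y" for k :: nat
    proof -
      have qz: "q z \<in> {X, Y, X \<otimes>\<^bsub>H\<^esub> Y}"
        using z(1) xy by (elim insertE emptyE) simp_all
      have "q (z [^]\<^bsub>G\<^esub> k) \<in> generate H {q z}"
      proof (induction k)
        case 0
        show ?case by (simp add: generate.one)
      next
        case (Suc k)
        then show ?case using generate.eng[OF Suc generate.incl[of "q z" "{q z}"]] zG by simp
      qed
      moreover have "q (z [^]\<^bsub>G\<^esub> k) = inv\<^bsub>H\<^esub> \<one>\<^bsub>H\<^esub> \<otimes>\<^bsub>H\<^esub> q (z [^]\<^bsub>G\<^esub> k) \<otimes>\<^bsub>H\<^esub> \<one>\<^bsub>H\<^esub>"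
        using zG by simp
      ultimately have "q (z [^]\<^bsub>G\<^esub> k) \<in> conj_set H \<one>\<^bsub>H\<^esub> (generate H {q z})"
        unfolding conj_set_def by (rule rev_image_eqI)
      with qz show ?thesis
        unfolding beauville_Sigma_def by (intro UN_I[OF H.one_closed]) (elim insertE emptyE, simp_all)
    qed
    then have "\<forall>k::nat. q (z [^]\<^bsub>G\<^esub> k) \<in> beauville_Sigma H X Y" by (rule allI)
    with z(2) zG show ?thesis by (intro bexI[of _ z] conjI)
  qed
  obtain z1 where z1: "z1 \<in> carrier G" "\<forall>m<n. \<not> p dvd level_sum m z1"
    "\<forall>k::nat. q (z1 [^]\<^bsub>G\<^esub> k) \<in> beauville_Sigma H X1 Y1"
    using full[OF gens(1-3)] by (elim bexE conjE)
  obtain z2 where z2: "z2 \<in> carrier G" "\<forall>m<n. \<not> p dvd level_sum m z2"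
    "\<forall>k::nat. q (z2 [^]\<^bsub>G\<^esub> k) \<in> beauville_Sigma H X2 Y2"
    using full[OF gens(4-6)] by (elim bexE conjE)
  obtain j k :: nat where eq: "q (z1 [^]\<^bsub>G\<^esub> j) = q (z2 [^]\<^bsub>G\<^esub> k)"
    and neq: "q (z2 [^]\<^bsub>G\<^esub> k) \<noteq> St n"
    using full_elements_common_power[OF z1(1,2) z2(1,2) n] unfolding q_def by (elim exE conjE)
  have "q (z2 [^]\<^bsub>G\<^esub> k) \<in> beauville_Sigma H X1 Y1 \<inter> beauville_Sigma H X2 Y2"
    using spec[OF z1(3), of j] spec[OF z2(3), of k] unfolding eq by (rule IntI)
  then have "q (z2 [^]\<^bsub>G\<^esub> k) = \<one>\<^bsub>H\<^esub>" unfolding disj by simp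
  then show False using neq unfolding H_def by simp
qed

end

theorem theoremB:
  fixes p n :: nat and e :: "nat \<Rightarrow> int"
  assumes "prime p" and "odd p"
    and "defining_vector p e"
    and "\<not> periodic_group (GGS_group p e)"
    and "n \<ge> 1"
  shows "\<not> beauville_group (GGS_group p e Mod GGS_stabilizer p e n)"
proof -
  interpret ggs_data p e
    using assms(1,3) by unfold_locales
      (auto simp: defining_vector_def residue_ring_def Pi_def)
  show ?thesis
    using quotient_not_beauville periodic_if_dvd_exponent_sum assms(4,5) by blast
qed

end
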